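(* Let $E$ be a Euclidean space, $F\colon E\to\mathbb R^m$ an analytic map with $m\leqslant\dim E$, and $x_0\in E$ with $\mathrm DF(x_0)$ surjective. Let $t\mapsto x_t$ be the maximal solution, on an interval containing $0$, of $\dot x_t=-\mathrm DF(x_t)^\dagger F(x_t)$ with initial value $x_0$, and write $\alpha_t=\alpha(F,x_t)$, $\beta_t=\beta(F,x_t)$. If $\alpha_0<\frac1{13}$, then $x_t$ is defined for all $t\geqslant0$ and (i) $F(x_t)=F(x_0)e^{-t}$; (ii) $\|x_t-x_0\|\leqslant 2\beta_0(1-e^{-t})$; (iii) $x_t$ converges as $t\to\infty$.
   Context: $\mathrm DF(x)^\dagger$ is the Moore–Penrose inverse of $\mathrm DF(x)$; the differential equation is defined on the open set of $x$ where $\mathrm DF(x)$ is surjective. For $x$ with $\mathrm DF(x)$ surjective, with spectral/operator norms: $\gamma(F,x)=\sup_{k\geq2}\big\|\frac1{k!}\mathrm DF(x)^\dagger\mathrm D^kF(x)\big\|^{1/(k-1)}$, $\beta(F,x)=\|\mathrm DF(x)^\dagger F(x)\|$, $\alpha(F,x)=\gamma(F,x)\beta(F,x)$. *)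

theory Defs
  imports "HOL-Analysis.Analysis"
begin

text \<open>Iterated Frechet derivatives. higher_deriv F k x is the k-th derivative of F at x,
  viewed as a k-linear map applied to a list of k direction vectors.\<close>
fun higher_deriv :: "('a::real_normed_vector \<Rightarrow> 'b::real_normed_vector) \<Rightarrow> nat \<Rightarrow> 'a \<Rightarrow> 'a list \<Rightarrow> 'b" where
  "higher_deriv F 0 = (\<lambda>x hs. F x)"
| "higher_deriv F (Suc k) =
     (\<lambda>x hs. frechet_derivative (\<lambda>y. higher_deriv F k y (tl hs)) (at x) (hd hs))"

definition smooth :: "('a::real_normed_vector \<Rightarrow> 'b::real_normed_vector) \<Rightarrow> bool" where
  "smooth F \<longleftrightarrow> (\<forall>k x hs. (\<lambda>y. higher_deriv F k y hs) differentiable (at x))"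

definition real_analytic :: "('a::real_normed_vector \<Rightarrow> 'b::real_normed_vector) \<Rightarrow> bool" where
  "real_analytic F \<longleftrightarrow> smooth F \<and>
     (\<forall>x. \<exists>r>0. \<forall>h. norm h < r \<longrightarrow>
        (\<lambda>k. (1 / fact k) *\<^sub>R higher_deriv F k x (replicate k h)) sums F (x + h))"

definition DF :: "('a::real_normed_vector \<Rightarrow> 'b::real_normed_vector) \<Rightarrow> 'a \<Rightarrow> 'a \<Rightarrow> 'b" where
  "DF F x = frechet_derivative F (at x)"

definition moore_penrose :: "('a::real_inner \<Rightarrow> 'b::real_inner) \<Rightarrow> 'b \<Rightarrow> 'a" where
  "moore_penrose A = (THE B. linear B \<and> A \<circ> B \<circ> A = A \<and> B \<circ> A \<circ> B = B \<and>
       adjoint (A \<circ> B) = A \<circ> B \<and> adjoint (B \<circ> A) = B \<circ> A)"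

definition multilin_norm :: "nat \<Rightarrow> ('a::real_normed_vector list \<Rightarrow> 'b::real_normed_vector) \<Rightarrow> real" where
  "multilin_norm k L = Sup {norm (L hs) | hs. length hs = k \<and> (\<forall>h\<in>set hs. norm h \<le> 1)}"

definition gamma_F :: "('a::euclidean_space \<Rightarrow> 'b::euclidean_space) \<Rightarrow> 'a \<Rightarrow> real" where
  "gamma_F F x = (SUP k\<in>{2..}. (multilin_norm k
       (\<lambda>hs. (1 / fact k) *\<^sub>R moore_penrose (DF F x) (higher_deriv F k x hs))) powr (1 / (real k - 1)))"

definition beta_F :: "('a::euclidean_space \<Rightarrow> 'b::euclidean_space) \<Rightarrow> 'a \<Rightarrow> real" where
  "beta_F F x = norm (moore_penrose (DF F x) (F x))"

definition alpha_F :: "('a::euclidean_space \<Rightarrow> 'b::euclidean_space) \<Rightarrow> 'a \<Rightarrow> real" where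
  "alpha_F F x = gamma_F F x * beta_F F x"

definition newton_flow_sol :: "('a::euclidean_space \<Rightarrow> 'b::euclidean_space) \<Rightarrow> real set \<Rightarrow> (real \<Rightarrow> 'a) \<Rightarrow> bool" where
  "newton_flow_sol F I x \<longleftrightarrow> (\<forall>t\<in>I. surj (DF F (x t)) \<and>
      (x has_vector_derivative - moore_penrose (DF F (x t)) (F (x t))) (at t within I))"

end

theory Submission
  imports Defs "HOL-Complex_Analysis.Complex_Analysis"
begin

text \<open>Write \<open>A = DF(x\<^sub>0)\<^sup>\<dagger>\<close>. Analyticity makes \<open>\<gamma>(F, x\<^sub>0)\<close> finite, so the Taylor series of \<open>A F\<close> at
  \<open>x\<^sub>0\<close> converges in the ball of radius \<open>1 / \<gamma>\<close> and, by the identity theorem on segments, represents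
  \<open>A F\<close> there. With \<open>u = \<gamma> \<parallel>x - x\<^sub>0\<parallel>\<close> this gives \<open>\<parallel>A (DF(x) - DF(x\<^sub>0))\<parallel> \<le> 1 / (1 - u)\<^sup>2 - 1\<close>.
  For \<open>u \<le> 2 / 13\<close> the right-hand side is below \<open>1 / 2\<close>, hence \<open>DF(x)\<close> is surjective with
  \<open>\<parallel>DF(x)\<^sup>\<dagger> y\<parallel> \<le> 2 \<parallel>A y\<parallel>\<close>. Along the flow \<open>F(x\<^sub>t) = e\<^sup>-\<^sup>t F(x\<^sub>0)\<close>, so the speed is at most
  \<open>2 \<beta>\<^sub>0 e\<^sup>-\<^sup>t\<close> as long as \<open>x\<^sub>t\<close> stays in the ball of radius \<open>2 \<beta>\<^sub>0\<close>, and this bound on the speed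
  prevents it from leaving the ball.\<close>

section \<open>Multilinear maps and symmetry of higher derivatives\<close>

text \<open>Analyticity is given direction by direction: for each small \<open>h\<close> the
  diagonal Taylor series converges, with no estimate uniform in \<open>h\<close>, whereas
  \<open>gamma_F\<close> involves norms of the full k-linear derivatives. To bridge this gap, the
  Baire category theorem yields one bound, valid for all \<open>k\<close>, on some ball of
  directions, and polarization, which rests on the symmetry of the derivatives, carries it over to
  arbitrary arguments. Since \<gamma> sees \<open>F\<close> only through the pseudoinverse
  \<open>A\<close>, every estimate concerns \<open>A F\<close>; this loses nothing, because
  \<open>A\<close> has the left inverse \<open>DF(x0)\<close> and is injective. The bound 1 / (1 -
  u)^2 - 1 is the sum of (k + 1) u^k over k >= 1: the factor k + 1 counts the arguments exchanged
  when two diagonal terms of degree k + 1 are compared. A global solution is built directly by a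
  change of time, not by continuing a local one, and the estimates are shown for every solution on
  the half-line, so that no uniqueness statement is invoked.\<close>

fun multilinear :: "nat \<Rightarrow> ('a::real_vector list \<Rightarrow> 'b::real_vector) \<Rightarrow> bool" where
  "multilinear 0 L \<longleftrightarrow> True"
| "multilinear (Suc n) L \<longleftrightarrow>
     (\<forall>hs. length hs = n \<longrightarrow> linear (\<lambda>v. L (v # hs))) \<and> (\<forall>v. multilinear n (\<lambda>hs. L (v # hs)))"

lemma multilinear_compose_linear:
  assumes "linear A" "multilinear n L"
  shows "multilinear n (\<lambda>hs. A (L hs))"
  using assms(2)
proof (induction n arbitrary: L)
  case (Suc n)
  then show ?case
    using linear_compose[OF _ assms(1)] by (auto simp: o_def)
qed simp

text \<open>Differentiation in \<open>y\<close> commutes with linear combinations of the parameters.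
  Since \<open>frechet_derivative\<close> is a choice, uniqueness of the derivative is what
  identifies it with the combined one.\<close>

lemma multilinear_frechet_derivative:
  assumes "\<And>y. multilinear k (G y)" "\<And>hs. (\<lambda>y. G y hs) differentiable at x"
  shows "multilinear k (\<lambda>hs. frechet_derivative (\<lambda>y. G y hs) (at x) v)"
  using assms
proof (induction k arbitrary: G)
  case (Suc k)
  have d: "((\<lambda>y. G y hs) has_derivative frechet_derivative (\<lambda>y. G y hs) (at x)) (at x)" for hs
    using Suc.prems(2) by (simp add: frechet_derivative_works)
  have "linear (\<lambda>u. frechet_derivative (\<lambda>y. G y (u # hs)) (at x) v)" if "length hs = k" for hs
  proof (rule linearI)
    have lin: "linear (\<lambda>u. G y (u # hs))" for y
      using Suc.prems(1) that by simp
    fix u u' :: 'b and r :: real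
    have "((\<lambda>y. G y ((u + u') # hs)) has_derivative
      (\<lambda>v. frechet_derivative (\<lambda>y. G y (u # hs)) (at x) v + frechet_derivative (\<lambda>y. G y (u' # hs)) (at x) v)) (at x)"
      unfolding linear_add[OF lin] by (intro has_derivative_add d)
    from frechet_derivative_at[OF this]
    show "frechet_derivative (\<lambda>y. G y ((u + u') # hs)) (at x) v =
      frechet_derivative (\<lambda>y. G y (u # hs)) (at x) v + frechet_derivative (\<lambda>y. G y (u' # hs)) (at x) v"
      by metis
    have "((\<lambda>y. G y ((r *\<^sub>R u) # hs)) has_derivative
      (\<lambda>v. r *\<^sub>R frechet_derivative (\<lambda>y. G y (u # hs)) (at x) v)) (at x)"
      unfolding linear_scale[OF lin] by (intro has_derivative_scaleR_right d)
    from frechet_derivative_at[OF this]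
    show "frechet_derivative (\<lambda>y. G y ((r *\<^sub>R u) # hs)) (at x) v =
      r *\<^sub>R frechet_derivative (\<lambda>y. G y (u # hs)) (at x) v"
      by metis
  qed
  moreover have "multilinear k (\<lambda>hs. frechet_derivative (\<lambda>y. G y (u # hs)) (at x) v)" for u
    by (rule Suc.IH) (use Suc.prems in auto)
  ultimately show ?case by simp
qed simp

lemma real_analytic_imp_smooth: "real_analytic F \<Longrightarrow> smooth F"
  by (simp add: real_analytic_def)

lemma smooth_differentiable:
  "smooth F \<Longrightarrow> (\<lambda>y. higher_deriv F k y hs) differentiable (at x)"
  by (simp add: smooth_def)

lemma multilinear_higher_deriv:
  assumes "smooth F"
  shows "multilinear k (higher_deriv F k x)"
proof (induction k arbitrary: x)
  case (Suc k)
  have "linear (frechet_derivative (\<lambda>y. higher_deriv F k y hs) (at x))" for hs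
    using smooth_differentiable[OF assms] by (rule linear_frechet_derivative)
  moreover have "multilinear k (\<lambda>hs. frechet_derivative (\<lambda>y. higher_deriv F k y hs) (at x) v)" for v
    by (rule multilinear_frechet_derivative) (use Suc.IH smooth_differentiable[OF assms] in auto)
  ultimately show ?case by (simp add: linear_conv_bounded_linear[symmetric])
qed simp

text \<open>Finite dimension replaces continuity: expanding the head in the orthonormal basis bounds
  \<open>L\<close> by the sum of the constants for a basis vector in front.\<close>

lemma multilinear_bounded:
  fixes L :: "'a::euclidean_space list \<Rightarrow> 'b::real_normed_vector"
  assumes "multilinear n L"
  shows "\<exists>C\<ge>0. \<forall>hs. length hs = n \<longrightarrow> norm (L hs) \<le> C * prod_list (map norm hs)"
  using assms
proof (induction n arbitrary: L)
  case 0
  then show ?case by (intro exI[of _ "norm (L [])"]) auto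
next
  case (Suc n)
  have "\<forall>b. \<exists>C\<ge>0. \<forall>hs. length hs = n \<longrightarrow> norm (L (b # hs)) \<le> C * prod_list (map norm hs)"
    using Suc by auto
  then obtain C where C: "\<And>b. C b \<ge> 0"
    "\<And>b hs. length hs = n \<Longrightarrow> norm (L (b # hs)) \<le> C b * prod_list (map norm hs)"
    by metis
  have "norm (L hs) \<le> (\<Sum>b\<in>Basis. C b) * prod_list (map norm hs)" if hs: "length hs = Suc n" for hs
  proof -
    obtain h t where [simp]: "hs = h # t" and t: "length t = n"
      using hs by (cases hs) auto
    have lin: "linear (\<lambda>v. L (v # t))" using Suc.prems t by simp
    have nn: "0 \<le> prod_list (map norm t)" by (induction t) auto
    have "L hs = L ((\<Sum>b\<in>Basis. (h \<bullet> b) *\<^sub>R b) # t)" by (simp add: euclidean_representation)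
    also have "\<dots> = (\<Sum>b\<in>Basis. (h \<bullet> b) *\<^sub>R L (b # t))"
      by (simp add: linear_sum[OF lin] linear_scale[OF lin])
    also have "norm \<dots> \<le> (\<Sum>b\<in>Basis. norm h * (C b * prod_list (map norm t)))"
    proof (rule sum_norm_le)
      fix b :: 'a assume b: "b \<in> Basis"
      have "\<bar>h \<bullet> b\<bar> \<le> norm h" using b by (rule Basis_le_norm)
      then show "norm ((h \<bullet> b) *\<^sub>R L (b # t)) \<le> norm h * (C b * prod_list (map norm t))"
        using C(2)[of t b] C(1)[of b] t nn by (auto intro!: mult_mono)
    qed
    also have "\<dots> = (\<Sum>b\<in>Basis. C b) * prod_list (map norm hs)"
      by (simp add: sum_distrib_right sum_distrib_left algebra_simps)
    finally show ?thesis .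
  qed
  then show ?case using C(1) by (intro exI[of _ "\<Sum>b\<in>Basis. C b"]) (auto intro: sum_nonneg)
qed

lemma prod_list_norm_nonneg: "0 \<le> prod_list (map norm hs)"
  by (induction hs) auto

text \<open>Replacing the head by its \<open>sgn\<close> pulls out its norm, and the shorter map
  \<open>L (sgn h # us)\<close> obeys the unit-ball bound with the same \<open>C\<close>. Zero heads
  fit in because \<open>sgn 0 = 0\<close>.\<close>

lemma multilinear_bound_from_unit_ball:
  fixes L :: "'a::real_normed_vector list \<Rightarrow> 'b::real_normed_vector"
  assumes "multilinear n L" "0 \<le> C" "length hs = n"
    and "\<And>hs. length hs = n \<Longrightarrow> \<forall>h\<in>set hs. norm h \<le> 1 \<Longrightarrow> norm (L hs) \<le> C"
  shows "norm (L hs) \<le> C * prod_list (map norm hs)"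
  using assms
proof (induction n arbitrary: L hs)
  case (Suc n)
  then obtain h t where [simp]: "hs = h # t" and t: "length t = n"
    by (cases hs) auto
  have lin: "linear (\<lambda>v. L (v # t))" using Suc.prems t by simp
  have "norm h *\<^sub>R sgn h = h" by (cases "h = 0") (simp_all add: sgn_div_norm)
  then have "L hs = L ((norm h *\<^sub>R sgn h) # t)" by simp
  also have "\<dots> = norm h *\<^sub>R L (sgn h # t)" by (simp only: linear_scale[OF lin])
  finally have "norm (L hs) = norm h * norm (L (sgn h # t))" by simp
  also have "norm (L (sgn h # t)) \<le> C * prod_list (map norm t)"
  proof (rule Suc.IH)
    fix us :: "'a list" assume "length us = n" "\<forall>h\<in>set us. norm h \<le> 1"
    then show "norm (L (sgn h # us)) \<le> C"
      using Suc.prems(4)[of "sgn h # us"] by (auto simp: norm_sgn)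
  qed (use Suc.prems t in auto)
  finally show ?case by (simp add: mult_left_mono mult.left_commute)
qed auto

text \<open>\<open>multilin_norm\<close> is a real \<open>Sup\<close>, so boundedness is required
  before it can serve as an upper bound.\<close>

lemma bdd_above_multilin_norm:
  fixes L :: "'a::euclidean_space list \<Rightarrow> 'b::real_normed_vector"
  assumes "multilinear n L"
  shows "bdd_above {norm (L hs) | hs. length hs = n \<and> (\<forall>h\<in>set hs. norm h \<le> 1)}"
proof -
  obtain C where C: "C \<ge> 0" "\<And>hs. length hs = n \<Longrightarrow> norm (L hs) \<le> C * prod_list (map norm hs)"
    using multilinear_bounded[OF assms] by blast
  have "prod_list (map norm hs) \<le> 1" if "\<forall>h\<in>set hs. norm h \<le> 1" for hs :: "'a list"
    using that by (induction hs) (auto intro!: mult_le_one prod_list_norm_nonneg)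
  then have "norm (L hs) \<le> C" if "length hs = n" "\<forall>h\<in>set hs. norm h \<le> 1" for hs
    using C(2)[OF that(1)] that mult_left_le[OF _ C(1)] by (meson order_trans)
  then show ?thesis by (auto intro!: bdd_aboveI[of _ C])
qed

lemma norm_le_multilin_norm:
  fixes L :: "'a::euclidean_space list \<Rightarrow> 'b::real_normed_vector"
  assumes "multilinear n L" "length hs = n"
  shows "norm (L hs) \<le> multilin_norm n L * prod_list (map norm hs)"
proof (rule multilinear_bound_from_unit_ball[OF assms(1) _ assms(2)])
  show le: "norm (L hs) \<le> multilin_norm n L" if "length hs = n" "\<forall>h\<in>set hs. norm h \<le> 1" for hs
    unfolding multilin_norm_def using bdd_above_multilin_norm[OF assms(1)] that
    by (intro cSup_upper) auto
  show "0 \<le> multilin_norm n L"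
    using le[of "replicate n 0"] by (auto intro: order_trans[OF norm_ge_zero])
qed

lemma multilin_norm_nonneg:
  fixes L :: "'a::euclidean_space list \<Rightarrow> 'b::real_normed_vector"
  assumes "multilinear n L"
  shows "0 \<le> multilin_norm n L"
proof -
  have "norm (L (replicate n 0)) \<le> multilin_norm n L"
    unfolding multilin_norm_def using bdd_above_multilin_norm[OF assms]
    by (intro cSup_upper CollectI exI[of _ "replicate n 0"]) auto
  then show ?thesis by (auto intro: order_trans[OF norm_ge_zero])
qed

lemma multilin_norm_least:
  fixes L :: "'a::real_normed_vector list \<Rightarrow> 'b::real_normed_vector"
  assumes "\<And>hs. length hs = n \<Longrightarrow> \<forall>h\<in>set hs. norm h \<le> 1 \<Longrightarrow> norm (L hs) \<le> C"
  shows "multilin_norm n L \<le> C"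
  unfolding multilin_norm_def
  by (rule cSup_least) (use assms in \<open>auto intro!: exI[of _ "replicate n 0"]\<close>)

text \<open>Telescoping: the arguments \<open>h\<close> are exchanged for \<open>h'\<close> one at a
  time, and each of the \<open>n\<close> exchanges costs
  \<open>C * \<rho> ^ (n - 1) * norm (h - h')\<close>.\<close>

lemma multilinear_diagonal_lipschitz:
  fixes L :: "'a::real_normed_vector list \<Rightarrow> 'b::real_normed_vector"
  assumes "multilinear n L" "0 \<le> C" "\<And>hs. length hs = n \<Longrightarrow> norm (L hs) \<le> C * prod_list (map norm hs)"
    and "norm h \<le> \<rho>" "norm h' \<le> \<rho>"
  shows "norm (L (replicate n h) - L (replicate n h')) \<le> C * (real n * \<rho> ^ (n - 1)) * norm (h - h')"
  using assms(1-3)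
proof (induction n arbitrary: L C)
  case (Suc n)
  have \<rho>: "0 \<le> \<rho>" using assms(4) norm_ge_zero order_trans by blast
  have lin: "linear (\<lambda>v. L (v # replicate n h))" using Suc.prems by simp
  have pl: "prod_list (map norm (replicate n h)) \<le> \<rho> ^ n"
    by (induction n) (use assms(4) \<rho> in \<open>auto intro!: mult_mono prod_list_norm_nonneg\<close>)
  have "norm (L ((h - h') # replicate n h)) \<le> C * (norm (h - h') * prod_list (map norm (replicate n h)))"
    using Suc.prems(3)[of "(h - h') # replicate n h"] by simp
  also have "\<dots> \<le> C * (norm (h - h') * \<rho> ^ n)"
    using pl Suc.prems(2) by (intro mult_left_mono) auto
  finally have 1: "norm (L ((h - h') # replicate n h)) \<le> C * (norm (h - h') * \<rho> ^ n)" .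
  have "norm (L (h' # replicate n h) - L (h' # replicate n h'))
    \<le> C * norm h' * (real n * \<rho> ^ (n - 1)) * norm (h - h')"
  proof (rule Suc.IH)
    fix hs :: "'a list" assume "length hs = n"
    then show "norm (L (h' # hs)) \<le> C * norm h' * prod_list (map norm hs)"
      using Suc.prems(3)[of "h' # hs"] by (simp add: mult.assoc)
  qed (use Suc.prems in auto)
  also have "\<dots> \<le> C * \<rho> * (real n * \<rho> ^ (n - 1)) * norm (h - h')"
    using assms(5) Suc.prems(2) \<rho> by (intro mult_right_mono mult_left_mono) auto
  also have "\<dots> = C * (real n * \<rho> ^ n) * norm (h - h')"
    by (cases n) auto
  finally have 2: "norm (L (h' # replicate n h) - L (h' # replicate n h')) \<le> C * (real n * \<rho> ^ n) * norm (h - h')" .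
  have "L (replicate (Suc n) h) - L (replicate (Suc n) h') =
     L ((h - h') # replicate n h) + (L (h' # replicate n h) - L (h' # replicate n h'))"
    by (simp add: linear_diff[OF lin])
  also have "norm \<dots> \<le> C * (norm (h - h') * \<rho> ^ n) + C * (real n * \<rho> ^ n) * norm (h - h')"
    by (rule norm_triangle_le[OF add_mono[OF 1 2]])
  finally show ?case by (simp add: algebra_simps)
qed simp

section \<open>Symmetry of mixed derivatives\<close>

lemma has_vector_derivative_along_line:
  assumes "g differentiable (at (x + t *\<^sub>R v))"
  shows "((\<lambda>t. g (x + t *\<^sub>R v)) has_vector_derivative frechet_derivative g (at (x + t *\<^sub>R v)) v) (at t)"
proof -
  have g: "(g has_derivative frechet_derivative g (at (x + t *\<^sub>R v))) (at (x + t *\<^sub>R v))"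
    using assms by (simp add: frechet_derivative_works)
  have "((\<lambda>t. x + t *\<^sub>R v) has_vector_derivative v) (at t)"
    by (auto intro!: derivative_eq_intros simp: has_vector_derivative_def)
  from vector_derivative_diff_chain_within[OF this has_derivative_at_withinI[OF g]]
  show ?thesis by (simp add: o_def)
qed

text \<open>The mean value theorem is applied twice: along \<open>a\<close> to the
  \<open>b\<close>-increment of \<open>f\<close>, and along \<open>b\<close> to the derivative of
  \<open>f\<close> in direction \<open>a\<close>.\<close>

lemma second_difference_eq_second_derivative:
  fixes f :: "'a::real_normed_vector \<Rightarrow> real"
  assumes d1: "\<And>x. f differentiable (at x)"
    and d2: "\<And>x. (\<lambda>y. frechet_derivative f (at y) a) differentiable (at x)"
    and r: "0 < r"
  shows "\<exists>\<xi> \<eta>. 0 \<le> \<xi> \<and> \<xi> \<le> r \<and> 0 \<le> \<eta> \<and> \<eta> \<le> r \<and>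
    f (x + r *\<^sub>R a + r *\<^sub>R b) - f (x + r *\<^sub>R a) - f (x + r *\<^sub>R b) + f x =
    r\<^sup>2 * frechet_derivative (\<lambda>y. frechet_derivative f (at y) a) (at (x + \<xi> *\<^sub>R a + \<eta> *\<^sub>R b)) b"
proof -
  define D where "D = (\<lambda>y. frechet_derivative f (at y) a)"
  define p where "p = (\<lambda>s. f (x + r *\<^sub>R b + s *\<^sub>R a) - f (x + s *\<^sub>R a))"
  have p': "(p has_real_derivative D (x + r *\<^sub>R b + s *\<^sub>R a) - D (x + s *\<^sub>R a)) (at s)" for s
    unfolding p_def D_def has_real_derivative_iff_has_vector_derivative
    by (intro has_vector_derivative_diff has_vector_derivative_along_line d1)
  obtain \<xi> where \<xi>: "0 < \<xi>" "\<xi> < r" "p r - p 0 = (r - 0) * (D (x + r *\<^sub>R b + \<xi> *\<^sub>R a) - D (x + \<xi> *\<^sub>R a))"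
    using MVT2[OF r p'] by blast
  define q where "q = (\<lambda>t. D (x + \<xi> *\<^sub>R a + t *\<^sub>R b))"
  have q': "(q has_real_derivative frechet_derivative D (at (x + \<xi> *\<^sub>R a + t *\<^sub>R b)) b) (at t)" for t
    unfolding q_def D_def has_real_derivative_iff_has_vector_derivative
    by (intro has_vector_derivative_along_line d2)
  obtain \<eta> where \<eta>: "0 < \<eta>" "\<eta> < r" "q r - q 0 = (r - 0) * frechet_derivative D (at (x + \<xi> *\<^sub>R a + \<eta> *\<^sub>R b)) b"
    using MVT2[OF r q'] by blast
  have "p r - p 0 = r * (q r - q 0)"
    unfolding \<xi>(3) q_def by (simp add: algebra_simps)
  also have "\<dots> = r\<^sup>2 * frechet_derivative D (at (x + \<xi> *\<^sub>R a + \<eta> *\<^sub>R b)) b"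
    unfolding \<eta>(3) by (simp add: power2_eq_square)
  finally show ?thesis using \<xi> \<eta> unfolding D_def p_def
    by (intro exI[of _ \<xi>] exI[of _ \<eta>]) (auto simp: algebra_simps)
qed

text \<open>The second difference does not change when \<open>a\<close> and \<open>b\<close> are
  exchanged, so the two mixed derivatives take equal values at points arbitrarily near
  \<open>x\<close>; continuity at \<open>x\<close> does the rest.\<close>

lemma second_derivative_symmetric_real:
  fixes f :: "'a::real_normed_vector \<Rightarrow> real"
  assumes d1: "\<And>x. f differentiable (at x)"
    and d2: "\<And>x v. (\<lambda>y. frechet_derivative f (at y) v) differentiable (at x)"
    and c: "\<And>v w. isCont (\<lambda>y. frechet_derivative (\<lambda>z. frechet_derivative f (at z) v) (at y) w) x"
  shows "frechet_derivative (\<lambda>y. frechet_derivative f (at y) a) (at x) b =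
    frechet_derivative (\<lambda>y. frechet_derivative f (at y) b) (at x) a"
proof (rule ccontr)
  define H where "H = (\<lambda>v w y. frechet_derivative (\<lambda>z. frechet_derivative f (at z) v) (at y) w)"
  assume neq: "\<not> ?thesis"
  define e where "e = \<bar>H a b x - H b a x\<bar> / 2"
  have e: "e > 0" using neq unfolding e_def H_def by simp
  have cH: "isCont (H v w) x" for v w unfolding H_def by (rule c)
  obtain d1 where d1': "d1 > 0" "\<And>y. dist y x < d1 \<Longrightarrow> dist (H a b y) (H a b x) < e"
    using cH[of a b] e unfolding continuous_at_eps_delta by blast
  obtain d2 where d2': "d2 > 0" "\<And>y. dist y x < d2 \<Longrightarrow> dist (H b a y) (H b a x) < e"
    using cH[of b a] e unfolding continuous_at_eps_delta by blast
  \<comment> \<open>The summand 1 keeps the denominator positive for \<open>a = b = 0\<close> and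
    makes \<open>r * (norm a + norm b)\<close> strictly smaller than both radii.\<close>
  define r where "r = min d1 d2 / (norm a + norm b + 1)"
  have nz: "norm a + norm b + 1 > 0" using norm_ge_zero[of a] norm_ge_zero[of b] by linarith
  have r: "r > 0" using d1' d2' nz unfolding r_def by simp
  have rd: "r * (norm a + norm b) < min d1 d2"
  proof -
    have "r * (norm a + norm b) < r * (norm a + norm b + 1)" using r by simp
    also have "\<dots> = min d1 d2" using nz unfolding r_def by simp
    finally show ?thesis .
  qed
  have near: "dist (x + s *\<^sub>R u + t *\<^sub>R v) x < min d1 d2"
    if "0 \<le> s" "s \<le> r" "0 \<le> t" "t \<le> r" "norm u + norm v = norm a + norm b" for s t u v
  proof -
    have "dist (x + s *\<^sub>R u + t *\<^sub>R v) x = norm (s *\<^sub>R u + t *\<^sub>R v)" by (simp add: dist_norm)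
    also have "\<dots> \<le> s * norm u + t * norm v"
      by (rule norm_triangle_le) (use that in auto)
    also have "\<dots> \<le> r * norm u + r * norm v" using that by (intro add_mono mult_right_mono) auto
    also have "\<dots> = r * (norm a + norm b)" using that(5) by (simp add: distrib_left[symmetric])
    finally show ?thesis using rd by simp
  qed
  obtain s t where st: "0 \<le> s" "s \<le> r" "0 \<le> t" "t \<le> r"
    "f (x + r *\<^sub>R a + r *\<^sub>R b) - f (x + r *\<^sub>R a) - f (x + r *\<^sub>R b) + f x = r\<^sup>2 * H a b (x + s *\<^sub>R a + t *\<^sub>R b)"
    using second_difference_eq_second_derivative[OF d1 d2 r, of x a b] unfolding H_def by blast
  obtain s' t' where st': "0 \<le> s'" "s' \<le> r" "0 \<le> t'" "t' \<le> r"
    "f (x + r *\<^sub>R b + r *\<^sub>R a) - f (x + r *\<^sub>R b) - f (x + r *\<^sub>R a) + f x = r\<^sup>2 * H b a (x + s' *\<^sub>R b + t' *\<^sub>R a)"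
    using second_difference_eq_second_derivative[OF d1 d2 r, of x b a] unfolding H_def by blast
  have "r\<^sup>2 * H a b (x + s *\<^sub>R a + t *\<^sub>R b) = r\<^sup>2 * H b a (x + s' *\<^sub>R b + t' *\<^sub>R a)"
    using st(5) st'(5) by (simp add: algebra_simps)
  then have "H a b (x + s *\<^sub>R a + t *\<^sub>R b) = H b a (x + s' *\<^sub>R b + t' *\<^sub>R a)" using r by simp
  moreover have "dist (H a b (x + s *\<^sub>R a + t *\<^sub>R b)) (H a b x) < e"
    using near[OF st(1-4), of a b] by (intro d1') auto
  moreover have "dist (H b a (x + s' *\<^sub>R b + t' *\<^sub>R a)) (H b a x) < e"
    using near[OF st'(1-4), of b a] by (intro d2') auto
  ultimately have "\<bar>H a b x - H b a x\<bar> < e + e" unfolding dist_real_def by linarith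
  then show False unfolding e_def by simp
qed

lemma frechet_derivative_inner_left:
  assumes "f differentiable (at x)"
  shows "frechet_derivative (\<lambda>y. f y \<bullet> w) (at x) v = frechet_derivative f (at x) v \<bullet> w"
proof -
  have "((\<lambda>y. f y \<bullet> w) has_derivative (\<lambda>v. frechet_derivative f (at x) v \<bullet> w)) (at x)"
    using assms by (intro has_derivative_inner_left) (simp add: frechet_derivative_works)
  from frechet_derivative_at[OF this] show ?thesis by metis
qed

text \<open>The mean value theorem behind the scalar case fails for vector values; pairing with an
  arbitrary fixed \<open>w\<close> reduces to it.\<close>

lemma second_derivative_symmetric:
  fixes f :: "'a::real_normed_vector \<Rightarrow> 'b::real_inner"
  assumes d1: "\<And>x. f differentiable (at x)"
    and d2: "\<And>x v. (\<lambda>y. frechet_derivative f (at y) v) differentiable (at x)"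
    and c: "\<And>v w. isCont (\<lambda>y. frechet_derivative (\<lambda>z. frechet_derivative f (at z) v) (at y) w) x"
  shows "frechet_derivative (\<lambda>y. frechet_derivative f (at y) a) (at x) b =
    frechet_derivative (\<lambda>y. frechet_derivative f (at y) b) (at x) a"
proof -
  have "frechet_derivative (\<lambda>y. frechet_derivative f (at y) a) (at x) b \<bullet> w =
    frechet_derivative (\<lambda>y. frechet_derivative f (at y) b) (at x) a \<bullet> w" for w
  proof -
    have d: "(\<lambda>y. f y \<bullet> w) differentiable (at x)" for x
      using d1[of x] by (auto simp: differentiable_def intro: has_derivative_inner_left)
    have D: "frechet_derivative (\<lambda>y. f y \<bullet> w) (at x) = (\<lambda>v. frechet_derivative f (at x) v \<bullet> w)" for x
      using frechet_derivative_inner_left[OF d1] by blast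
    have DD: "frechet_derivative (\<lambda>y. frechet_derivative (\<lambda>y. f y \<bullet> w) (at y) v) (at x) =
      (\<lambda>u. frechet_derivative (\<lambda>y. frechet_derivative f (at y) v) (at x) u \<bullet> w)" for v x
      unfolding D using frechet_derivative_inner_left[OF d2] by blast
    have d': "(\<lambda>y. frechet_derivative (\<lambda>y. f y \<bullet> w) (at y) v) differentiable (at x)" for v x
      unfolding D using d2[of v x] by (auto simp: differentiable_def intro: has_derivative_inner_left)
    have c': "isCont (\<lambda>y. frechet_derivative (\<lambda>z. frechet_derivative (\<lambda>y. f y \<bullet> w) (at z) v) (at y) u) x" for v u
      unfolding DD by (intro continuous_inner c continuous_const)
    show ?thesis
      using second_derivative_symmetric_real[OF d d' c', of a b] unfolding DD .
  qed
  then show ?thesis using vector_eq_rdot by blast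
qed

definition symmetric_map :: "nat \<Rightarrow> ('a list \<Rightarrow> 'b) \<Rightarrow> bool" where
  "symmetric_map n L \<longleftrightarrow> (\<forall>hs hs'. length hs = n \<longrightarrow> mset hs = mset hs' \<longrightarrow> L hs = L hs')"

lemma symmetric_mapD: "symmetric_map n L \<Longrightarrow> length hs = n \<Longrightarrow> mset hs = mset hs' \<Longrightarrow> L hs = L hs'"
  by (auto simp: symmetric_map_def)

lemma symmetric_map_Cons: "symmetric_map (Suc n) L \<Longrightarrow> symmetric_map n (\<lambda>hs. L (v # hs))"
  by (auto simp: symmetric_map_def)

text \<open>Two kinds of rearrangement suffice. Permuting the tail is the induction hypothesis under
  the derivative; exchanging the two leading directions is symmetry of the second derivative of
  \<open>higher_deriv F m\<close> with the other directions frozen. If the heads \<open>a\<close>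
  and \<open>b\<close> differ, \<open>b\<close> is moved to second place, exchanged with
  \<open>a\<close>, and the tail is rearranged.\<close>

lemma symmetric_map_higher_deriv:
  fixes F :: "'a::real_normed_vector \<Rightarrow> 'b::real_inner"
  assumes "smooth F"
  shows "symmetric_map n (higher_deriv F n x)"
proof (induction n arbitrary: x)
  case (Suc n)
  have tail: "higher_deriv F (Suc n) x (a # us) = higher_deriv F (Suc n) x (a # vs)"
    if "length us = n" "mset us = mset vs" for a us vs
  proof -
    have "(\<lambda>y. higher_deriv F n y us) = (\<lambda>y. higher_deriv F n y vs)"
      using symmetric_mapD[OF Suc.IH that] by blast
    then show ?thesis by simp
  qed
  show ?case unfolding symmetric_map_def
  proof (intro allI impI)
    fix hs hs' :: "'a list" assume len: "length hs = Suc n" and ms: "mset hs = mset hs'"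
    have len': "length hs' = Suc n" using len ms by (metis size_mset)
    obtain a as where hs: "hs = a # as" using len by (cases hs) auto
    obtain b bs where hs': "hs' = b # bs" using len' by (cases hs') auto
    show "higher_deriv F (Suc n) x hs = higher_deriv F (Suc n) x hs'"
    proof (cases "a = b")
      case True
      then show ?thesis using tail[of as bs a] ms len unfolding hs hs' by auto
    next
      case False
      have b: "b \<in> set as" using ms False unfolding hs hs' by (metis list.set_intros(1) set_ConsD set_mset_mset)
      define cs where "cs = remove1 b as"
      have as: "mset as = mset (b # cs)" using b unfolding cs_def by simp
      have bs: "mset bs = mset (a # cs)" using ms as unfolding hs hs' by (simp add: add_mset_commute)
      obtain m where m: "n = Suc m" using b len unfolding hs by (cases n) auto
      have lcs: "length cs = m" using as len m unfolding hs
        by (metis Suc_inject length_Cons size_mset)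
      define g where "g = (\<lambda>y. higher_deriv F m y cs)"
      have D: "frechet_derivative g (at y) v = higher_deriv F (Suc m) y (v # cs)" for y v
        by (simp add: g_def)
      have DD: "frechet_derivative (\<lambda>y. frechet_derivative g (at y) v) (at y) w =
        higher_deriv F (Suc (Suc m)) y (w # v # cs)" for y v w
        by (simp add: g_def)
      have "higher_deriv F (Suc n) x (a # b # cs) = higher_deriv F (Suc n) x (b # a # cs)"
        unfolding m DD[symmetric]
      proof (rule second_derivative_symmetric)
        show "g differentiable at y" for y
          unfolding g_def by (rule smooth_differentiable[OF assms])
        show "(\<lambda>y. frechet_derivative g (at y) v) differentiable at y" for y v
          unfolding D by (rule smooth_differentiable[OF assms])
        show "isCont (\<lambda>y. frechet_derivative (\<lambda>z. frechet_derivative g (at z) v) (at y) w) x" for v w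
          unfolding DD by (rule differentiable_imp_continuous_within[OF smooth_differentiable[OF assms]])
      qed
      moreover have "higher_deriv F (Suc n) x hs = higher_deriv F (Suc n) x (a # b # cs)"
        unfolding hs by (rule tail) (use len hs as in auto)
      moreover have "higher_deriv F (Suc n) x hs' = higher_deriv F (Suc n) x (b # a # cs)"
        unfolding hs' by (rule tail) (use len' hs' bs in auto)
      ultimately show ?thesis by simp
    qed
  qed
qed (simp add: symmetric_map_def)

text \<open>This is the product rule, with symmetry moving every \<open>v\<close> to the head. The
  induction splits the head \<open>h + t v\<close> linearly: a head fixed at \<open>h\<close> or at
  \<open>v\<close> leaves a diagonal map of one degree less.\<close>

lemma diagonal_has_vector_derivative:
  fixes L :: "'a::real_normed_vector list \<Rightarrow> 'b::real_normed_vector"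
  assumes "multilinear (Suc n) L" "symmetric_map (Suc n) L"
  shows "((\<lambda>t. L (replicate (Suc n) (h + t *\<^sub>R v))) has_vector_derivative
    real (Suc n) *\<^sub>R L (v # replicate n (h + t *\<^sub>R v))) (at t)"
  using assms
proof (induction n arbitrary: L)
  case 0
  then have lin: "linear (\<lambda>v. L [v])" by simp
  show ?case
    by (auto simp: linear_add[OF lin] linear_scale[OF lin] has_vector_derivative_def intro!: derivative_eq_intros)
next
  case (Suc n)
  let ?x = "\<lambda>t. h + t *\<^sub>R v"
  have lin: "linear (\<lambda>v. L (v # hs))" if "length hs = Suc n" for hs using Suc.prems(1) that by simp
  have IH: "((\<lambda>t. L (u # replicate (Suc n) (?x t))) has_vector_derivative
    real (Suc n) *\<^sub>R L (u # v # replicate n (?x t))) (at t)" for u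
    by (rule Suc.IH[OF _ symmetric_map_Cons]) (use Suc.prems in auto)
  have "((\<lambda>t. L (h # replicate (Suc n) (?x t)) + t *\<^sub>R L (v # replicate (Suc n) (?x t)))
    has_vector_derivative (real (Suc n) *\<^sub>R L (h # v # replicate n (?x t)) +
     (t *\<^sub>R (real (Suc n) *\<^sub>R L (v # v # replicate n (?x t))) + 1 *\<^sub>R L (v # replicate (Suc n) (?x t))))) (at t)"
    by (intro has_vector_derivative_add has_vector_derivative_scaleR IH) (rule derivative_intros)
  moreover have "L (h # replicate (Suc n) (?x t)) + t *\<^sub>R L (v # replicate (Suc n) (?x t)) =
    L (replicate (Suc (Suc n)) (?x t))" for t
    using linear_add[OF lin[of "replicate (Suc n) (?x t)"], of h "t *\<^sub>R v"]
      linear_scale[OF lin[of "replicate (Suc n) (?x t)"], of t v] by simp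
  moreover have "real (Suc n) *\<^sub>R L (h # v # replicate n (?x t)) +
     (t *\<^sub>R (real (Suc n) *\<^sub>R L (v # v # replicate n (?x t))) + 1 *\<^sub>R L (v # replicate (Suc n) (?x t)))
     = real (Suc (Suc n)) *\<^sub>R L (v # replicate (Suc n) (?x t))"
  proof -
    have "L (h # v # replicate n (?x t)) + t *\<^sub>R L (v # v # replicate n (?x t)) = L (?x t # v # replicate n (?x t))"
      using linear_add[OF lin[of "v # replicate n (?x t)"], of h "t *\<^sub>R v"]
      linear_scale[OF lin[of "v # replicate n (?x t)"], of t v] by simp
    also have "\<dots> = L (v # ?x t # replicate n (?x t))"
      by (rule symmetric_mapD[OF Suc.prems(2)]) auto
    also have "\<dots> = L (v # replicate (Suc n) (?x t))" by simp
    finally have "real (Suc n) *\<^sub>R (L (h # v # replicate n (?x t)) + t *\<^sub>R L (v # v # replicate n (?x t)))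
      = real (Suc n) *\<^sub>R L (v # replicate (Suc n) (?x t))" by simp
    moreover have "real (Suc (Suc n)) *\<^sub>R L (v # replicate (Suc n) (?x t)) =
      real (Suc n) *\<^sub>R L (v # replicate (Suc n) (?x t)) + L (v # replicate (Suc n) (?x t))"
      by (simp only: of_nat_Suc[of "Suc n"] scaleR_left_distrib scaleR_one add.commute)
    ultimately show ?thesis
      by (simp add: scaleR_add_right mult.commute add_ac del: replicate_Suc of_nat_Suc)
  qed
  ultimately show ?case by simp
qed

section \<open>Iterated differences and polarization\<close>

fun iterated_difference :: "'a::ab_group_add list \<Rightarrow> ('a \<Rightarrow> 'b::ab_group_add) \<Rightarrow> 'a \<Rightarrow> 'b" where
  "iterated_difference [] g h = g h"
| "iterated_difference (v # vs) g h = iterated_difference vs g (h + v) - iterated_difference vs g h"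

lemma iterated_difference_scaleR:
  "iterated_difference vs (\<lambda>x. c *\<^sub>R g x) h = c *\<^sub>R iterated_difference vs g h"
  for g :: "'a::ab_group_add \<Rightarrow> 'b::real_vector"
  by (induction vs arbitrary: h) (simp_all add: scaleR_diff_right)

lemma iterated_difference_has_vector_derivative:
  assumes "\<And>x. ((\<lambda>t. g (x + t *\<^sub>R v)) has_vector_derivative g' (x + t *\<^sub>R v)) (at t)"
  shows "((\<lambda>t. iterated_difference vs g (x + t *\<^sub>R v)) has_vector_derivative
    iterated_difference vs g' (x + t *\<^sub>R v)) (at t)"
proof (induction vs arbitrary: x)
  case (Cons u vs)
  then show ?case
    using has_vector_derivative_diff[OF Cons[of "x + u"] Cons[of x]] by (simp add: add_ac)
qed (simp add: assms)

text \<open>By induction, the difference over \<open>vs\<close> along \<open>h + t v\<close> has the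
  constant derivative \<open>fact n *\<^sub>R L (v # vs)\<close> in \<open>t\<close>; it is
  therefore affine, and its increment from 0 to 1 is the difference with \<open>v\<close> included.
  The base point \<open>h\<close> is arbitrary because the Baire argument supplies a ball around an
  unknown centre.\<close>

lemma polarization:
  fixes L :: "'a::real_normed_vector list \<Rightarrow> 'b::real_normed_vector"
  assumes "multilinear n L" "symmetric_map n L" "length vs = n"
  shows "iterated_difference vs (\<lambda>h. L (replicate n h)) h = fact n *\<^sub>R L vs"
  using assms
proof (induction vs arbitrary: n L h)
  case (Cons v vs)
  then obtain m where n: "n = Suc m" and m: "length vs = m" by auto
  let ?g = "\<lambda>h. L (replicate n h)"
  let ?g' = "\<lambda>h. real (Suc m) *\<^sub>R L (v # replicate m h)"
  have IH: "iterated_difference vs (\<lambda>h. L (v # replicate m h)) h = fact m *\<^sub>R L (v # vs)" for h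
    by (rule Cons.IH) (use Cons.prems n m symmetric_map_Cons in auto)
  have *: "iterated_difference vs ?g' h = fact n *\<^sub>R L (v # vs)" for h
    unfolding iterated_difference_scaleR IH n by simp
  have "((\<lambda>t. iterated_difference vs ?g (h + t *\<^sub>R v)) has_vector_derivative
    iterated_difference vs ?g' (h + t *\<^sub>R v)) (at t)" for t
    unfolding n by (rule iterated_difference_has_vector_derivative, rule diagonal_has_vector_derivative)
      (use Cons.prems n in auto)
  then have d: "((\<lambda>t. iterated_difference vs ?g (h + t *\<^sub>R v)) has_vector_derivative fact n *\<^sub>R L (v # vs)) (at t)" for t
    unfolding * .
  have "((\<lambda>t. iterated_difference vs ?g (h + t *\<^sub>R v) - t *\<^sub>R (fact n *\<^sub>R L (v # vs))) has_derivative (\<lambda>_. 0)) (at t)" for t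
    by (rule has_derivative_eq_rhs, rule has_derivative_diff[OF d[unfolded has_vector_derivative_def]])
      (auto intro!: derivative_eq_intros)
  then obtain c where "\<And>t. iterated_difference vs ?g (h + t *\<^sub>R v) - t *\<^sub>R (fact n *\<^sub>R L (v # vs)) = c"
    using has_derivative_zero_constant[OF convex_UNIV, of "\<lambda>t. iterated_difference vs ?g (h + t *\<^sub>R v) - t *\<^sub>R (fact n *\<^sub>R L (v # vs))"]
    by auto
  from this[of 0] this[of 1] show ?case by (simp add: algebra_simps)
qed simp

text \<open>The iterated difference is a signed sum of \<open>2 ^ length vs\<close> values of
  \<open>g\<close>, all taken within the total length of \<open>vs\<close> from
  \<open>h\<close>.\<close>

lemma norm_iterated_difference_le:
  fixes g :: "'a::real_normed_vector \<Rightarrow> 'b::real_normed_vector"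
  assumes "\<And>x. norm (x - h) \<le> sum_list (map norm vs) \<Longrightarrow> norm (g x) \<le> N"
  shows "norm (iterated_difference vs g h) \<le> 2 ^ length vs * N"
  using assms
proof (induction vs arbitrary: h)
  case (Cons v vs)
  have "norm (iterated_difference vs g (h + v)) \<le> 2 ^ length vs * N"
  proof (rule Cons.IH)
    fix x assume "norm (x - (h + v)) \<le> sum_list (map norm vs)"
    then show "norm (g x) \<le> N"
      using norm_triangle_ineq[of "x - (h + v)" v] by (intro Cons.prems) (simp add: algebra_simps)
  qed
  moreover have "norm (iterated_difference vs g h) \<le> 2 ^ length vs * N"
  proof (rule Cons.IH)
    fix x assume "norm (x - h) \<le> sum_list (map norm vs)"
    then show "norm (g x) \<le> N"
      using norm_ge_zero[of v] by (intro Cons.prems) (auto intro: add_increasing)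
  qed
  ultimately show ?case
    using norm_triangle_ineq4[of "iterated_difference vs g (h + v)" "iterated_difference vs g h"] by simp
qed simp

section \<open>The Moore-Penrose inverse of a surjective map\<close>

lemma ex1_moore_penrose_surj:
  fixes L :: "'a::euclidean_space \<Rightarrow> 'b::euclidean_space"
  assumes L: "linear L" and s: "surj L"
  shows "\<exists>!B. linear B \<and> L \<circ> B \<circ> L = L \<and> B \<circ> L \<circ> B = B \<and>
       adjoint (L \<circ> B) = L \<circ> B \<and> adjoint (B \<circ> L) = B \<circ> L"
proof -
  define S where "S = (\<lambda>y. L (adjoint L y))"
  have la: "linear (adjoint L)" using L by (rule adjoint_linear)
  have linS: "linear S" unfolding S_def using linear_compose[OF la L] by (simp add: o_def)
  have adj: "x \<bullet> adjoint L y = L x \<bullet> y" for x y by (rule adjoint_works[OF L])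
  have "inj S"
    unfolding linear_injective_0[OF linS]
  proof (intro allI impI)
    fix y assume "S y = 0"
    then have "L (adjoint L y) \<bullet> y = 0" by (simp add: S_def)
    then have z: "adjoint L y = 0" unfolding adj[symmetric] by simp
    obtain x where "L x = y" using s by (metis surjD)
    then have "y \<bullet> y = 0" using adj[of x y] z by simp
    then show "y = 0" by simp
  qed
  then obtain R where R: "linear R" "\<And>y. S (R y) = y"
    using linear_injective_isomorphism[OF linS] by metis
  have sym: "S x \<bullet> y = x \<bullet> S y" for x y
    unfolding S_def using adj[of "adjoint L x" y] adj[of "adjoint L y" x] by (simp add: inner_commute)
  have symR: "R x \<bullet> y = x \<bullet> R y" for x y
    using sym[of "R x" "R y"] R(2) by simp
  define B where "B = (\<lambda>y. adjoint L (R y))"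
  have LB: "L (B y) = y" for y using R(2) unfolding B_def S_def .
  have linB: "linear B" unfolding B_def using linear_compose[OF R(1) la] by (simp add: o_def)
  show ?thesis
  proof (rule ex1I[of _ B], intro conjI)
    show "linear B" "L \<circ> B \<circ> L = L" "B \<circ> L \<circ> B = B" by (auto simp: linB LB fun_eq_iff)
    show "adjoint (L \<circ> B) = L \<circ> B" by (rule adjoint_unique) (simp add: LB)
    have "B (L x) \<bullet> y = x \<bullet> B (L y)" for x y
      unfolding B_def adj using symR[of "L x" "L y"] adj[of y "R (L x)"] by (simp add: inner_commute)
    then show "adjoint (B \<circ> L) = B \<circ> L" by (intro adjoint_unique) simp
  next
    fix C assume C: "linear C \<and> L \<circ> C \<circ> L = L \<and> C \<circ> L \<circ> C = C \<and>
       adjoint (L \<circ> C) = L \<circ> C \<and> adjoint (C \<circ> L) = C \<circ> L"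
    have LC: "L (C y) = y" for y
      using C s by (metis comp_apply surjD)
    have symC: "C (L x) \<bullet> y = x \<bullet> C (L y)" for x y
      using adjoint_works[of "C \<circ> L" x y] C linear_compose[OF L, of C] by (simp add: inner_commute)
    have symB: "B (L x) \<bullet> y = x \<bullet> B (L y)" for x y
      unfolding B_def adj using symR[of "L x" "L y"] adj[of y "R (L x)"] by (simp add: inner_commute)
    have "C (L x) \<bullet> y = B (L x) \<bullet> y" for x y
    proof -
      have "C (L x) \<bullet> y = C (L (B (L x))) \<bullet> y" by (simp add: LB)
      also have "\<dots> = x \<bullet> B (L (C (L y)))" by (simp add: symC symB)
      also have "\<dots> = B (L x) \<bullet> y" by (simp add: LC symB)
      finally show ?thesis .
    qed
    then have "C (L x) = B (L x)" for x using vector_eq_rdot by blast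
    then show "C = B" using s by (metis ext surjD)
  qed
qed

context
  fixes L :: "'a::euclidean_space \<Rightarrow> 'b::euclidean_space"
  assumes L: "linear L" and s: "surj L"
begin

lemma linear_moore_penrose: "linear (moore_penrose L)"
  using theI'[OF ex1_moore_penrose_surj[OF L s]] unfolding moore_penrose_def by blast

lemma moore_penrose_right_inverse: "L (moore_penrose L y) = y"
  using theI'[OF ex1_moore_penrose_surj[OF L s]] s unfolding moore_penrose_def[symmetric]
  by (metis comp_apply surjD)

lemma moore_penrose_projection_symmetric:
  "moore_penrose L (L x) \<bullet> y = x \<bullet> moore_penrose L (L y)"
proof -
  have "adjoint (moore_penrose L \<circ> L) = moore_penrose L \<circ> L"
    using theI'[OF ex1_moore_penrose_surj[OF L s]] unfolding moore_penrose_def[symmetric] by blast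
  then show ?thesis
    using adjoint_works[OF linear_compose[OF L linear_moore_penrose], of x y] by simp
qed

text \<open>\<open>moore_penrose L \<circ> L\<close> is an orthogonal projection. Read for
  \<open>y = L z\<close>, the inequality says that the pseudoinverse selects a preimage of least
  norm.\<close>

lemma norm_moore_penrose_projection_le: "norm (moore_penrose L (L z)) \<le> norm z"
proof -
  let ?p = "moore_penrose L (L z)"
  have "?p \<bullet> ?p = z \<bullet> ?p"
    using moore_penrose_projection_symmetric[of z ?p] by (simp add: moore_penrose_right_inverse)
  then have "norm ?p * norm ?p \<le> norm z * norm ?p"
    using norm_cauchy_schwarz[of z ?p] by (simp add: power2_norm_eq_inner[symmetric] power2_eq_square)
  then show ?thesis by (cases "norm ?p = 0") auto
qed

end

text \<open>The component \<open>w\<close> of \<open>M\<^sup>\<dagger> y\<close> in the kernel of \<open>L\<close> is of first order in \<open>L - M\<close>, because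
  \<open>M w = (M - L) w\<close> there.\<close>
lemma norm_moore_penrose_diff_le:
  fixes L M :: "'a::euclidean_space \<Rightarrow> 'b::euclidean_space"
  assumes L: "linear L" "surj L" and M: "linear M" "surj M"
    and d: "\<And>x. norm (L x - M x) \<le> \<delta> * norm x" "0 \<le> \<delta>"
    and bL: "\<And>y. norm (moore_penrose L y) \<le> k * norm y"
    and bM: "\<And>y. norm (moore_penrose M y) \<le> k * norm y" and k: "0 \<le> k"
  shows "norm (moore_penrose L y - moore_penrose M y) \<le> 2 * k\<^sup>2 * \<delta> * norm y"
proof -
  let ?A = "moore_penrose L" and ?B = "moore_penrose M"
  note LA = moore_penrose_right_inverse[OF L] and MB = moore_penrose_right_inverse[OF M]
  note linA = linear_moore_penrose[OF L] and linB = linear_moore_penrose[OF M]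
  define w where "w = ?B y - ?A (L (?B y))"
  have db: "norm (L (?B y) - y) \<le> \<delta> * (k * norm y)"
    using d(1)[of "?B y"] bM[of y] d(2) MB[of y] by (smt (verit) mult_left_mono)
  have Lw: "L w = 0" unfolding w_def by (simp add: linear_diff[OF L(1)] LA)
  have "w \<bullet> w = w \<bullet> ?B y"
  proof -
    have "w \<bullet> ?A (L (?B y)) = ?A (L w) \<bullet> ?B y"
      by (simp add: moore_penrose_projection_symmetric[OF L])
    then have "w \<bullet> ?A (L (?B y)) = 0" by (simp add: Lw linear_0[OF linA])
    then show ?thesis by (simp add: w_def inner_diff_right)
  qed
  also have "\<dots> = ?B (M w) \<bullet> ?B y"
    by (simp add: moore_penrose_projection_symmetric[OF M] MB)
  also have "\<dots> \<le> norm (?B (M w)) * norm (?B y)" by (rule norm_cauchy_schwarz)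
  also have "\<dots> \<le> (k * (\<delta> * norm w)) * (k * norm y)"
  proof (rule mult_mono)
    have "norm (M w) \<le> \<delta> * norm w" using d(1)[of w] Lw by simp
    then show "norm (?B (M w)) \<le> k * (\<delta> * norm w)"
      using bM[of "M w"] k by (smt (verit) mult_left_mono)
  qed (use bM k d in auto)
  finally have "norm w * norm w \<le> (k\<^sup>2 * \<delta> * norm y) * norm w"
    by (simp add: power2_norm_eq_inner[symmetric] power2_eq_square algebra_simps)
  then have 1: "norm w \<le> k\<^sup>2 * \<delta> * norm y"
    using k d(2) by (cases "norm w = 0") auto
  \<comment> \<open>The difference of the pseudoinverses is this vector minus \<open>w\<close>. Each
    of the two contributes \<open>k\<^sup>2 * \<delta> * norm y\<close>, whence the factor
    2.\<close>
  have "norm (?A (y - L (?B y))) \<le> k * (\<delta> * (k * norm y))"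
    using bL[of "y - L (?B y)"] db k by (smt (verit) mult_left_mono norm_minus_commute)
  then have "norm (?A (y - L (?B y)) - w) \<le> k * (\<delta> * (k * norm y)) + k\<^sup>2 * \<delta> * norm y"
    using 1 norm_triangle_ineq4[of "?A (y - L (?B y))" w] by linarith
  moreover have "?A y - ?B y = ?A (y - L (?B y)) - w"
    unfolding w_def by (simp add: linear_diff[OF linA])
  ultimately show ?thesis by (simp add: power2_eq_square mult_ac)
qed

section \<open>Finiteness of the gamma invariant\<close>

lemma multilinear_continuous_diagonal:
  fixes L :: "'a::euclidean_space list \<Rightarrow> 'b::real_normed_vector"
  assumes "multilinear n L"
  shows "continuous_on UNIV (\<lambda>h. L (replicate n h))"
proof -
  obtain C where C: "C \<ge> 0" "\<And>hs. length hs = n \<Longrightarrow> norm (L hs) \<le> C * prod_list (map norm hs)"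
    using multilinear_bounded[OF assms] by blast
  have "isCont (\<lambda>h. L (replicate n h)) x" for x
  proof -
    let ?R = "norm x + 1"
    have "(C * (real n * ?R ^ (n - 1)))-lipschitz_on (ball 0 ?R) (\<lambda>h. L (replicate n h))"
      unfolding lipschitz_on_def dist_norm
      using C multilinear_diagonal_lipschitz[OF assms C, of _ ?R] by auto
    then have "continuous_on (ball 0 ?R) (\<lambda>h. L (replicate n h))"
      by (rule lipschitz_on_continuous_on)
    then show ?thesis by (simp add: continuous_on_eq_continuous_at)
  qed
  then show ?thesis by (simp add: continuous_on_eq_continuous_at)
qed

lemma multilinear_map_scaleR:
  assumes "multilinear n L" "length hs = n"
  shows "L (map (\<lambda>h. c *\<^sub>R h) hs) = c ^ n *\<^sub>R L hs"
  using assms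
proof (induction hs arbitrary: n L)
  case (Cons h hs)
  then obtain m where n: "n = Suc m" and m: "length hs = m" by auto
  have lin: "linear (\<lambda>v. L (v # map (\<lambda>h. c *\<^sub>R h) hs))" using Cons.prems n m by simp
  have "L (h # map (\<lambda>h. c *\<^sub>R h) hs) = c ^ m *\<^sub>R L (h # hs)"
    by (rule Cons.IH[of m "\<lambda>us. L (h # us)"]) (use Cons.prems n m in auto)
  then show ?case using linear_scale[OF lin, of c h] n by simp
qed simp

lemma multilinear_replicate_scaleR:
  assumes "multilinear n L"
  shows "L (replicate n (c *\<^sub>R h)) = c ^ n *\<^sub>R L (replicate n h)"
  using multilinear_map_scaleR[OF assms, of "replicate n h" c] by (simp add: map_replicate_const)

text \<open>One term of the exponential series at \<open>k\<close> is at most the whole sum. The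
  geometric loss is harmless, because \<open>gamma_F\<close> takes roots of order
  \<open>k - 1\<close>.\<close>

lemma power_self_le_exp_mult_fact: "real k ^ k \<le> exp (real k) * fact k"
proof -
  have "(\<Sum>n\<in>{k}. real k ^ n /\<^sub>R fact n) \<le> (\<Sum>n. real k ^ n /\<^sub>R fact n)"
    by (rule sum_le_suminf[OF summable_exp_generic]) auto
  then have "real k ^ k / fact k \<le> exp (real k)" by (simp add: exp_def divide_inverse mult.commute)
  then show ?thesis by (simp add: divide_le_eq)
qed

text \<open>Each vector of the polarization formula is scaled to length at most \<open>s / (2 k)\<close>, so that all
  the evaluation points stay in the ball; the factor \<open>e ^ k\<close> comes from \<open>k ^ k / k!\<close>.\<close>
lemma multilinear_norm_le_of_diagonal:
  fixes L :: "'a::real_normed_vector list \<Rightarrow> 'b::real_normed_vector"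
  assumes "multilinear k L" "symmetric_map k L" "0 < s"
    and N: "\<And>x. norm (x - h0) < s \<Longrightarrow> norm (L (replicate k x)) \<le> N"
    and hs: "length hs = k" "\<forall>h\<in>set hs. norm h \<le> 1"
  shows "norm (L hs) \<le> N * (4 * exp 1 / s) ^ k"
proof (cases "k = 0")
  case True
  then show ?thesis using N[of h0] hs \<open>0 < s\<close> by simp
next
  case False
  have N0: "0 \<le> N" using N[of h0] \<open>0 < s\<close> by (auto intro: order_trans[OF norm_ge_zero])
  define c where "c = s / (2 * real k)"
  have c: "0 < c" unfolding c_def using False \<open>0 < s\<close> by simp
  define vs where "vs = map (\<lambda>h. c *\<^sub>R h) hs"
  have "sum_list (map norm vs) = c * sum_list (map norm hs)"
    using c unfolding vs_def by (simp add: sum_list_const_mult o_def)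
  also have "sum_list (map norm hs) \<le> real (length hs)"
    using hs(2) by (induction hs) auto
  then have "c * sum_list (map norm hs) \<le> c * real k" using c hs(1) by simp
  also have "\<dots> < s" using False \<open>0 < s\<close> unfolding c_def by simp
  finally have small: "sum_list (map norm vs) < s" .
  have len: "length vs = k" unfolding vs_def using hs by simp
  have "norm (iterated_difference vs (\<lambda>h. L (replicate k h)) h0) \<le> 2 ^ length vs * N"
    by (rule norm_iterated_difference_le) (use N small in force)
  then have "fact k * norm (L vs) \<le> 2 ^ k * N"
    unfolding polarization[OF assms(1,2) len] len by simp
  then have "fact k * (c ^ k * norm (L hs)) \<le> 2 ^ k * N"
    unfolding vs_def multilinear_map_scaleR[OF assms(1) hs(1)] using c by simp
  then have "real k ^ k * (fact k * (c ^ k * norm (L hs))) \<le> real k ^ k * (2 ^ k * N)"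
    by (rule mult_left_mono) simp
  then have "(real k ^ k * c ^ k) * (fact k * norm (L hs)) \<le> real k ^ k * (2 ^ k * N)"
    by (simp add: mult_ac)
  also have "\<dots> \<le> (exp (real k) * fact k) * (2 ^ k * N)"
    using power_self_le_exp_mult_fact N0 by (intro mult_right_mono) auto
  finally have "(real k ^ k * c ^ k) * norm (L hs) \<le> exp (real k) * (2 ^ k * N)"
    by (simp add: mult.left_commute[of _ "fact k"] mult.assoc)
  moreover have "real k ^ k * c ^ k = (s / 2) ^ k"
    unfolding power_mult_distrib[symmetric] c_def using False by simp
  moreover have "exp (real k) = exp 1 ^ k"
    by (simp add: exp_of_nat_mult[symmetric])
  ultimately have "(s / 2) ^ k * norm (L hs) \<le> exp 1 ^ k * (2 ^ k * N)"
    by metis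
  then have "(s / 2) ^ k * norm (L hs) \<le> N * (2 * exp 1) ^ k"
    by (simp only: power_mult_distrib mult_ac)
  moreover have "N * (2 * exp 1) ^ k = (s / 2) ^ k * (N * (4 * exp 1 / s) ^ k)"
  proof -
    have "(s / 2) ^ k * (4 * exp 1 / s) ^ k = (2 * exp 1) ^ k"
      unfolding power_mult_distrib[symmetric] using \<open>0 < s\<close> by simp
    then show ?thesis by (metis mult.left_commute)
  qed
  ultimately have "(s / 2) ^ k * norm (L hs) \<le> (s / 2) ^ k * (N * (4 * exp 1 / s) ^ k)"
    by (simp only:)
  moreover have "0 < (s / 2) ^ k" using \<open>0 < s\<close> by simp
  ultimately show ?thesis by (metis mult_le_cancel_left_pos)
qed

abbreviation taylor_coeff :: "('a::real_normed_vector \<Rightarrow> 'b::real_normed_vector) \<Rightarrow> 'a \<Rightarrow> nat \<Rightarrow> 'a list \<Rightarrow> 'b" where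
  "taylor_coeff F x k hs \<equiv> (1 / fact k) *\<^sub>R higher_deriv F k x hs"

lemma multilinear_taylor_coeff: "smooth F \<Longrightarrow> multilinear k (taylor_coeff F x k)"
  by (rule multilinear_compose_linear[OF linear_scaleR multilinear_higher_deriv])

lemma symmetric_map_taylor_coeff:
  fixes F :: "'a::real_normed_vector \<Rightarrow> 'b::real_inner"
  shows "smooth F \<Longrightarrow> symmetric_map k (taylor_coeff F x k)"
  using symmetric_map_higher_deriv[of F k x] by (simp add: symmetric_map_def)

text \<open>For each small \<open>h\<close> the terms tend to 0 and are bounded, so the closed sets
  \<open>E N\<close> cover a ball. If all of them had empty interior, their complements would be
  open and dense, and by Baire some small \<open>h\<close> would lie in no \<open>E N\<close>. The
  centre \<open>h0\<close> is whatever this argument yields and need not be 0.\<close>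

lemma real_analytic_uniform_diagonal_bound:
  fixes F :: "'a::euclidean_space \<Rightarrow> 'b::euclidean_space"
  assumes "real_analytic F"
  shows "\<exists>h0 s N. 0 < s \<and> (\<forall>k h. norm (h - h0) < s \<longrightarrow> norm (taylor_coeff F x k (replicate k h)) \<le> N)"
proof (rule ccontr)
  assume contra: "\<not> ?thesis"
  have sm: "smooth F" by (rule real_analytic_imp_smooth[OF assms])
  obtain r where r: "r > 0" "\<And>h. norm h < r \<Longrightarrow> (\<lambda>k. taylor_coeff F x k (replicate k h)) sums F (x + h)"
    using assms unfolding real_analytic_def by blast
  define E where "E = (\<lambda>N. {h. \<forall>k. norm (taylor_coeff F x k (replicate k h)) \<le> real N})"
  have clE: "closed (E N)" for N
    unfolding E_def
    by (intro closed_Collect_all closed_Collect_le continuous_intros multilinear_continuous_diagonal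
        multilinear_higher_deriv sm)
  have intE: "interior (E N) = {}" for N
  proof (rule ccontr)
    assume "interior (E N) \<noteq> {}"
    then obtain h0 s where "s > 0" "ball h0 s \<subseteq> E N"
      by (meson ex_in_conv mem_interior)
    then have "\<forall>k h. norm (h - h0) < s \<longrightarrow> norm (taylor_coeff F x k (replicate k h)) \<le> real N"
      unfolding E_def by (auto simp: subset_eq dist_norm norm_minus_commute)
    then show False using contra \<open>s > 0\<close> by blast
  qed
  have "UNIV \<subseteq> closure (\<Inter>(range (\<lambda>N. - E N)))"
  proof (rule Baire)
    fix T assume "T \<in> range (\<lambda>N. - E N)"
    then show "openin (top_of_set UNIV) T \<and> UNIV \<subseteq> closure T"
      using clE intE by (auto simp: closure_complement open_Compl)
  qed auto
  then have "0 \<in> closure (\<Inter>(range (\<lambda>N. - E N)))" by blast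
  moreover have "0 \<in> ball (0 :: 'a) r" using r(1) by simp
  ultimately have "closure (\<Inter>(range (\<lambda>N. - E N))) \<inter> ball 0 r \<noteq> {}"
    by (metis IntI empty_iff)
  then obtain h where h: "h \<in> ball 0 r" "h \<in> \<Inter>(range (\<lambda>N. - E N))"
    by (metis Int_commute disjoint_iff open_Int_closure_eq_empty[OF open_ball])
  have "summable (\<lambda>k. taylor_coeff F x k (replicate k h))"
    using r(2)[of h] h(1) by (auto simp: sums_iff)
  then have "Bseq (\<lambda>k. taylor_coeff F x k (replicate k h))"
    by (intro convergent_imp_Bseq) (metis convergent_def summable_LIMSEQ_zero)
  then obtain M where M: "\<And>k. norm (taylor_coeff F x k (replicate k h)) \<le> M"
    unfolding Bseq_def by blast
  obtain N where "M \<le> real N" using real_arch_simple by blast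
  then have "h \<in> E N" unfolding E_def using M order_trans by blast
  then show False using h(2) by blast
qed

lemma real_analytic_taylor_coeff_bound:
  fixes F :: "'a::euclidean_space \<Rightarrow> 'b::euclidean_space"
  assumes "real_analytic F"
  shows "\<exists>N C. 0 \<le> N \<and> 0 \<le> C \<and>
    (\<forall>k hs. length hs = k \<longrightarrow> (\<forall>h\<in>set hs. norm h \<le> 1) \<longrightarrow> norm (taylor_coeff F x k hs) \<le> N * C ^ k)"
proof -
  have sm: "smooth F" by (rule real_analytic_imp_smooth[OF assms])
  obtain h0 s N where s: "0 < s"
    and N: "\<And>k h. norm (h - h0) < s \<Longrightarrow> norm (taylor_coeff F x k (replicate k h)) \<le> N"
    using real_analytic_uniform_diagonal_bound[OF assms] by blast
  have "norm (taylor_coeff F x k hs) \<le> N * (4 * exp 1 / s) ^ k"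
    if "length hs = k" "\<forall>h\<in>set hs. norm h \<le> 1" for k hs
    using multilinear_norm_le_of_diagonal[OF multilinear_taylor_coeff[OF sm, of k x]
        symmetric_map_taylor_coeff[OF sm, of k x] s N that] .
  moreover have "0 \<le> N" using N[of h0 0] s norm_ge_zero order_trans by (metis diff_self norm_zero)
  ultimately show ?thesis using s by (intro exI[of _ N] exI[of _ "4 * exp 1 / s"]) auto
qed

text \<open>The scaling stays outside the pseudoinverse so that the expression is literally the one
  under the supremum in \<open>gamma_F\<close>.\<close>

abbreviation newton_coeff :: "('a::euclidean_space \<Rightarrow> 'b::euclidean_space) \<Rightarrow> 'a \<Rightarrow> nat \<Rightarrow> 'a list \<Rightarrow> 'a" where
  "newton_coeff F x k hs \<equiv> (1 / fact k) *\<^sub>R moore_penrose (DF F x) (higher_deriv F k x hs)"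

lemma DF_has_derivative:
  assumes "smooth F"
  shows "(F has_derivative DF F x) (at x)"
  using smooth_differentiable[OF assms, of 0] by (simp add: DF_def frechet_derivative_works)

lemma linear_DF: "smooth F \<Longrightarrow> linear (DF F x)"
  by (rule has_derivative_linear[OF DF_has_derivative])

lemma DF_eq_higher_deriv: "DF F x v = higher_deriv F (Suc 0) x [v]"
  by (simp add: DF_def)

context
  fixes F :: "'a::euclidean_space \<Rightarrow> 'b::euclidean_space" and x :: 'a
  assumes an: "real_analytic F" and sj: "surj (DF F x)"
begin

lemma linear_DF_inverse: "linear (moore_penrose (DF F x))"
  by (rule linear_moore_penrose[OF linear_DF[OF real_analytic_imp_smooth[OF an]] sj])

lemma multilinear_newton_coeff: "multilinear k (newton_coeff F x k)"
  by (intro multilinear_compose_linear[OF linear_scaleR]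
      multilinear_compose_linear[OF linear_DF_inverse] multilinear_higher_deriv real_analytic_imp_smooth an)

text \<open>Without this bound the real supremum in \<open>gamma_F\<close> would be an unspecified value.\<close>
lemma bdd_above_gamma:
  "bdd_above ((\<lambda>k. multilin_norm k (newton_coeff F x k) powr (1 / (real k - 1))) ` {2..})"
proof -
  obtain N C where NC: "0 \<le> N" "0 \<le> C" "\<And>k hs. length hs = k \<Longrightarrow> \<forall>h\<in>set hs. norm h \<le> 1 \<Longrightarrow>
    norm (taylor_coeff F x k hs) \<le> N * C ^ k"
    using real_analytic_taylor_coeff_bound[OF an] by blast
  obtain b where b: "b > 0" "\<And>y. norm (moore_penrose (DF F x) y) \<le> b * norm y"
    using linear_bounded_pos[OF linear_DF_inverse] by blast
  \<comment> \<open>With both constants at least 1, \<open>M * D ^ k\<close> is at most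
    \<open>(M * D\<^sup>2) ^ (k - 1)\<close>, since \<open>1 \<le> k - 1\<close> and
    \<open>k \<le> 2 * (k - 1)\<close> for \<open>k \<ge> 2\<close>; the root of order
    \<open>k - 1\<close> is then independent of \<open>k\<close>.\<close>
  define M where "M = max 1 (b * N)"
  define D where "D = max 1 C"
  have MD: "1 \<le> M" "b * N \<le> M" "1 \<le> D" "C \<le> D" unfolding M_def D_def by auto
  have "multilin_norm k (newton_coeff F x k) powr (1 / (real k - 1)) \<le> M * D\<^sup>2" if k: "2 \<le> k" for k
  proof -
    have "multilin_norm k (newton_coeff F x k) \<le> M * D ^ k"
    proof (rule multilin_norm_least)
      fix hs :: "'a list" assume hs: "length hs = k" "\<forall>h\<in>set hs. norm h \<le> 1"
      have "newton_coeff F x k hs = moore_penrose (DF F x) (taylor_coeff F x k hs)"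
        by (simp add: linear_scale[OF linear_DF_inverse])
      then have "norm (newton_coeff F x k hs) \<le> b * norm (taylor_coeff F x k hs)"
        using b(2) by metis
      also have "\<dots> \<le> b * (N * C ^ k)"
        by (rule mult_left_mono[OF NC(3)[OF hs]]) (use b(1) in simp)
      also have "\<dots> = (b * N) * C ^ k" by simp
      also have "\<dots> \<le> M * D ^ k"
        using MD NC b by (intro mult_mono power_mono) auto
      finally show "norm (newton_coeff F x k hs) \<le> M * D ^ k" .
    qed
    also have "\<dots> \<le> M ^ (k - 1) * (D\<^sup>2) ^ (k - 1)"
    proof (rule mult_mono)
      show "M \<le> M ^ (k - 1)" using power_increasing[of 1 "k - 1" M] MD k by simp
      show "D ^ k \<le> (D\<^sup>2) ^ (k - 1)"
        unfolding power_mult[symmetric] by (rule power_increasing) (use MD k in auto)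
    qed (use MD in auto)
    also have "\<dots> = (M * D\<^sup>2) ^ (k - 1)" by (simp add: power_mult_distrib)
    finally have "multilin_norm k (newton_coeff F x k) \<le> (M * D\<^sup>2) ^ (k - 1)" .
    then have "multilin_norm k (newton_coeff F x k) powr (1 / (real k - 1)) \<le> ((M * D\<^sup>2) ^ (k - 1)) powr (1 / (real k - 1))"
      by (intro powr_mono2 multilin_norm_nonneg multilinear_newton_coeff) (use k in auto)
    also have "\<dots> = M * D\<^sup>2"
    proof -
      have "0 < M * D\<^sup>2" using MD by (intro mult_pos_pos) auto
      then have "((M * D\<^sup>2) ^ (k - 1)) powr (1 / (real k - 1)) = (M * D\<^sup>2) powr (real (k - 1) * (1 / (real k - 1)))"
        by (metis powr_realpow powr_powr)
      also have "real (k - 1) * (1 / (real k - 1)) = 1" using k by (simp add: of_nat_diff)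
      finally show ?thesis using \<open>0 < M * D\<^sup>2\<close> by simp
    qed
    finally show ?thesis .
  qed
  then show ?thesis by (intro bdd_aboveI2) auto
qed

lemma gamma_F_nonneg: "0 \<le> gamma_F F x"
  unfolding gamma_F_def
  by (rule order_trans[OF _ cSUP_upper[OF _ bdd_above_gamma, of 2]]) auto

lemma multilin_norm_le_gamma_F:
  assumes "2 \<le> k"
  shows "multilin_norm k (newton_coeff F x k) \<le> gamma_F F x ^ (k - 1)"
proof -
  let ?m = "multilin_norm k (newton_coeff F x k)"
  have m: "0 \<le> ?m" by (rule multilin_norm_nonneg[OF multilinear_newton_coeff])
  have "?m powr (1 / (real k - 1)) \<le> gamma_F F x"
    unfolding gamma_F_def by (rule cSUP_upper[OF _ bdd_above_gamma]) (use assms in simp)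
  then have "(?m powr (1 / (real k - 1))) ^ (k - 1) \<le> gamma_F F x ^ (k - 1)"
    by (rule power_mono) simp
  moreover have "(?m powr (1 / (real k - 1))) ^ (k - 1) = ?m"
  \<comment> \<open>\<open>powr_realpow\<close> requires a positive base. For a zero norm both sides
    vanish because \<open>k - 1\<close> is positive.\<close>
  proof (cases "?m = 0")
    case False
    then have "(?m powr (1 / (real k - 1))) ^ (k - 1) = ?m powr ((1 / (real k - 1)) * real (k - 1))"
      using m by (subst powr_realpow[symmetric]) (auto simp: powr_powr)
    then show ?thesis using assms m False by (simp add: of_nat_diff)
  qed (use assms in simp)
  ultimately show ?thesis by simp
qed

text \<open>The supremum in \<open>gamma_F\<close> starts at 2. For \<open>k = 1\<close> the
  coefficient is an orthogonal projection, of norm at most 1 =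
  \<open>gamma_F F x ^ 0\<close>.\<close>

lemma norm_newton_coeff_le:
  assumes "1 \<le> k" "length hs = k"
  shows "norm (newton_coeff F x k hs) \<le> gamma_F F x ^ (k - 1) * prod_list (map norm hs)"
proof (cases "k = 1")
  case True
  then obtain h where hs: "hs = [h]" using assms by (auto simp: length_Suc_conv)
  show ?thesis
    using norm_moore_penrose_projection_le[OF linear_DF[OF real_analytic_imp_smooth[OF an]] sj, of h] True hs
    by (simp add: DF_def)
next
  case False
  then have "2 \<le> k" using assms by simp
  have "norm (newton_coeff F x k hs) \<le> multilin_norm k (newton_coeff F x k) * prod_list (map norm hs)"
    by (rule norm_le_multilin_norm[OF multilinear_newton_coeff assms(2)])
  also have "\<dots> \<le> gamma_F F x ^ (k - 1) * prod_list (map norm hs)"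
    by (rule mult_right_mono[OF multilin_norm_le_gamma_F[OF \<open>2 \<le> k\<close>] prod_list_norm_nonneg])
  finally show ?thesis .
qed

end

section \<open>Taylor expansion with the gamma invariant\<close>

text \<open>Near the first point where the two functions would differ, both extend holomorphically, and
  the extensions agree on a real interval to the left of that point.\<close>
lemma real_analytic_identity:
  fixes f :: "real \<Rightarrow> real"
  assumes loc: "\<And>t. \<exists>r>0. \<exists>a. \<forall>s. \<bar>s - t\<bar> < r \<longrightarrow> (\<lambda>k. a k * (s - t) ^ k) sums f s"
    and zero: "0 < r0" "\<And>s. \<bar>s\<bar> < r0 \<Longrightarrow> (\<lambda>k. c k * s ^ k) sums f s"
    and summ: "\<And>s. \<bar>s\<bar> < \<rho> \<Longrightarrow> summable (\<lambda>k. c k * s ^ k)"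
    and t: "0 \<le> t" "t < \<rho>"
  shows "(\<lambda>k. c k * t ^ k) sums f t"
proof -
  define G where "G = (\<lambda>z::complex. \<Sum>k. of_real (c k) * z ^ k)"
  have Gs: "(\<lambda>k. of_real (c k) * z ^ k) sums G z" if z: "norm z < \<rho>" for z
  proof -
    define s where "s = (norm z + \<rho>) / 2"
    have s: "norm z < s" "s < \<rho>" unfolding s_def using z by simp_all
    have "0 < s" using s(1) by (rule le_less_trans[OF norm_ge_zero])
    note s = s this
    have "summable (\<lambda>k. complex_of_real (c k * s ^ k))"
      using summ[of s] s by (intro summable_of_real) auto
    then have "summable (\<lambda>k. complex_of_real (c k) * of_real s ^ k)" by simp
    from powser_inside[OF this, of z] s show ?thesis unfolding G_def by (simp add: summable_sums)
  qed
  define g where "g = (\<lambda>s. \<Sum>k. c k * s ^ k)"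
  have gs: "(\<lambda>k. c k * s ^ k) sums g s" if "\<bar>s\<bar> < \<rho>" for s
    unfolding g_def using summ[OF that] by (rule summable_sums)
  have Gg: "G (of_real s) = of_real (g s)" if "\<bar>s\<bar> < \<rho>" for s
    using sums_unique2[OF Gs[of "of_real s"]] sums_of_real[OF gs[OF that]] that by force
  have holG: "G holomorphic_on ball 0 \<rho>"
    by (rule power_series_holomorphic[where a = "\<lambda>k. of_real (c k)"]) (use Gs in auto)
  have "f t = g t"
  proof (rule ccontr)
    assume ne: "f t \<noteq> g t"
    define S where "S = {s. 0 \<le> s \<and> s < \<rho> \<and> f s \<noteq> g s}"
    define b where "b = Inf S"
    have tS: "t \<in> S" unfolding S_def using ne t by simp
    have bddS: "bdd_below S" unfolding S_def by (rule bdd_belowI[of _ 0]) auto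
    have bS: "b \<le> s" if "s \<in> S" for s unfolding b_def by (rule cInf_lower[OF that bddS])
    have bt: "b \<le> t" by (rule bS[OF tS])
    have below: "f s = g s" if "0 \<le> s" "s < b" for s
      using bS[of s] that bt t unfolding S_def by force
    have near0: "f s = g s" if "\<bar>s\<bar> < r0" for s
      using sums_unique[OF zero(2)[OF that]] unfolding g_def by simp
    \<comment> \<open>Agreement near 0 keeps \<open>b\<close> away from 0, which leaves room for a
      common interval to the left of \<open>b\<close>.\<close>
    have b0: "0 < b"
    proof -
      have "r0 \<le> b" unfolding b_def
      proof (rule cInf_greatest)
        show "r0 \<le> s" if "s \<in> S" for s
          using near0[of s] that unfolding S_def by force
      qed (use tS in auto)
      then show ?thesis using zero(1) by simp
    qed
    obtain r a where r: "r > 0" and a: "\<And>s. \<bar>s - b\<bar> < r \<Longrightarrow> (\<lambda>k. a k * (s - b) ^ k) sums f s"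
      using loc[of b] by blast
    define H where "H = (\<lambda>z::complex. \<Sum>k. of_real (a k) * (z - of_real b) ^ k)"
    have Hs: "(\<lambda>k. of_real (a k) * (z - of_real b) ^ k) sums H z" if z: "norm (z - of_real b) < r" for z
    proof -
      define s where "s = (norm (z - of_real b) + r) / 2"
      have s: "norm (z - of_real b) < s" "s < r" unfolding s_def using z by simp_all
      have "0 < s" using s(1) by (rule le_less_trans[OF norm_ge_zero])
      note s = s this
      have "summable (\<lambda>k. complex_of_real (a k * s ^ k))"
        using a[of "b + s"] s by (intro summable_of_real) (auto simp: sums_iff)
      then have "summable (\<lambda>k. complex_of_real (a k) * of_real s ^ k)" by simp
      from powser_inside[OF this, of "z - of_real b"] s show ?thesis
        unfolding H_def by (simp add: summable_sums)
    qed
    have Hf: "H (of_real s) = of_real (f s)" if "\<bar>s - b\<bar> < r" for s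
    proof -
      have "norm (complex_of_real s - of_real b) < r" using that by (simp flip: of_real_diff)
      from sums_unique2[OF Hs[OF this]] sums_of_real[OF a[OF that]] show ?thesis by force
    qed
    \<comment> \<open>\<open>q \<le> b\<close> keeps the left interval in the range where
      \<open>f\<close> and \<open>g\<close> already agree, \<open>q \<le> \<rho> - b\<close> keeps
      the disc inside the domain of \<open>G\<close>, and \<open>q \<le> r\<close> keeps it inside
      that of \<open>H\<close>.\<close>
    define q where "q = Min {r, \<rho> - b, b}"
    have q: "0 < q" "q \<le> r" "q \<le> \<rho> - b" "q \<le> b" unfolding q_def using r bt t b0 by auto
    have holH: "H holomorphic_on ball (of_real b) r"
      by (rule power_series_holomorphic[where a = "\<lambda>k. of_real (a k)"])
        (use Hs in \<open>auto simp: dist_norm norm_minus_commute\<close>)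
    have sub: "ball (of_real b) q \<subseteq> ball (0::complex) \<rho>"
    proof
      fix z :: complex assume "z \<in> ball (of_real b) q"
      then have "norm (z - of_real b) < q" by (simp add: dist_norm norm_minus_commute)
      moreover have "norm (complex_of_real b) = b" using b0 by simp
      ultimately have "norm z < q + b"
        using norm_triangle_ineq[of "z - of_real b" "of_real b"] by simp
      then show "z \<in> ball 0 \<rho>" using q by simp
    qed
    define U where "U = complex_of_real ` {b - q<..<b}"
    have GH: "H z - G z = 0" if z: "z \<in> ball (of_real b) q" for z
    proof (rule analytic_continuation[where f = "\<lambda>z. H z - G z" and w = z and U = U and \<xi> = "of_real b" and S = "ball (of_real b) q"])
      show "(\<lambda>z. H z - G z) holomorphic_on ball (of_real b) q"
        by (intro holomorphic_on_diff holomorphic_on_subset[OF holH] holomorphic_on_subset[OF holG sub])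
          (use q in auto)
      show "U \<subseteq> ball (of_real b) q"
        unfolding U_def by (auto simp: dist_norm simp flip: of_real_diff)
      show "complex_of_real b islimpt U"
        unfolding islimpt_approachable
      proof (intro allI impI)
        fix e :: real assume e: "e > 0"
        define s where "s = b - min e q / 2"
        have "s \<in> {b - q<..<b}" "\<bar>s - b\<bar> < e" "s \<noteq> b" unfolding s_def using e q by auto
        then show "\<exists>x'\<in>U. x' \<noteq> complex_of_real b \<and> dist x' (complex_of_real b) < e"
          unfolding U_def by (intro bexI[of _ "of_real s"]) (auto simp: dist_norm simp flip: of_real_diff)
      qed
      show "H z - G z = 0" if zU: "z \<in> U" for z
      proof -
        obtain s where s: "z = of_real s" "b - q < s" "s < b" using zU unfolding U_def by auto
        have "f s = g s" using below[of s] s q by simp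
        then show ?thesis using Hf[of s] Gg[of s] s q bt t by simp
      qed
    qed (use z q in auto)
    have agree: "f s = g s" if "b \<le> s" "s < b + q" for s
    proof -
      have "complex_of_real s \<in> ball (of_real b) q"
        using that by (simp add: dist_norm flip: of_real_diff)
      from GH[OF this] show ?thesis
        using Hf[of s] Gg[of s] that q b0 by (simp flip: of_real_diff)
    qed
    have "b + q \<le> s" if "s \<in> S" for s
      using that agree[of s] bS[OF that] unfolding S_def by force
    then have "b + q \<le> Inf S" using tS by (intro cInf_greatest) auto
    then show False using q unfolding b_def by simp
  qed
  then show ?thesis using gs[of t] t by simp
qed

text \<open>Difference quotients along \<open>v\<close> are at most \<open>c * norm v\<close> and
  approach \<open>g' v\<close>. This turns an estimate for increments into one for the derivative,
  without termwise differentiation of a power series in several variables.\<close>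

lemma lipschitz_imp_norm_derivative_le:
  fixes g :: "'a::real_normed_vector \<Rightarrow> 'b::real_normed_vector"
  assumes d: "(g has_derivative g') (at x)" and S: "open S" "x \<in> S"
    and lip: "\<And>y z. y \<in> S \<Longrightarrow> z \<in> S \<Longrightarrow> norm (g y - g z) \<le> c * norm (y - z)"
  shows "norm (g' v) \<le> c * norm v"
proof -
  have lin: "linear g'" using d by (rule has_derivative_linear)
  have le: "norm (g' v) \<le> c * norm v + e * norm v" if e: "e > 0" for e
  proof -
    obtain \<delta> where \<delta>: "\<delta> > 0" "\<And>y. norm (y - x) < \<delta> \<Longrightarrow> norm (g y - g x - g' (y - x)) \<le> e * norm (y - x)"
      using d e unfolding has_derivative_at_alt by blast
    obtain r where r: "r > 0" "ball x r \<subseteq> S" using S open_contains_ball by blast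
    define t where "t = min \<delta> r / (norm v + 1)"
    have nz: "norm v + 1 > 0" by (simp add: add_nonneg_pos)
    have t: "t > 0" unfolding t_def using \<delta> r nz by simp
    have "t * norm v < t * (norm v + 1)" using t by simp
    also have "\<dots> = min \<delta> r" unfolding t_def using nz by simp
    finally have small: "norm (t *\<^sub>R v) < min \<delta> r" using t by simp
    have "norm (g' (t *\<^sub>R v)) \<le> norm (g (x + t *\<^sub>R v) - g x) + norm (g (x + t *\<^sub>R v) - g x - g' (t *\<^sub>R v))"
      using norm_triangle_ineq4[of "g (x + t *\<^sub>R v) - g x" "g (x + t *\<^sub>R v) - g x - g' (t *\<^sub>R v)"] by simp
    also have "norm (g (x + t *\<^sub>R v) - g x) \<le> c * norm (t *\<^sub>R v)"
      using lip[of "x + t *\<^sub>R v" x] small r(2) S(2) by (auto simp: subset_eq dist_norm)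
    also have "norm (g (x + t *\<^sub>R v) - g x - g' (t *\<^sub>R v)) \<le> e * norm (t *\<^sub>R v)"
      using \<delta>(2)[of "x + t *\<^sub>R v"] small by simp
    finally have "t * norm (g' v) \<le> t * (c * norm v + e * norm v)"
      using t by (simp add: linear_scale[OF lin] algebra_simps)
    then show ?thesis using t by simp
  qed
  show ?thesis
  proof (rule field_le_epsilon)
    fix e :: real assume e: "e > 0"
    have "e / (norm v + 1) * norm v \<le> e" using e by (simp add: divide_simps add_nonneg_pos)
    then show "norm (g' v) \<le> c * norm v + e"
      using le[of "e / (norm v + 1)"] e by (simp add: add_nonneg_pos)
  qed
qed

context
  fixes F :: "'a::euclidean_space \<Rightarrow> 'b::euclidean_space" and x0 :: 'a
  assumes an: "real_analytic F" and sj: "surj (DF F x0)"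
begin

text \<open>Restricting to the segment \<open>x0 + t *\<^sub>R h\<close> and pairing with
  \<open>w\<close> leaves a real function of \<open>t\<close>, to which the identity theorem
  applies; the claim is its value at \<open>t = 1\<close>.\<close>

lemma newton_coeff_sums:
  assumes h: "gamma_F F x0 * norm h < 1"
  shows "(\<lambda>k. newton_coeff F x0 k (replicate k h) \<bullet> w) sums (moore_penrose (DF F x0) (F (x0 + h)) \<bullet> w)"
proof -
  let ?\<gamma> = "gamma_F F x0" and ?A = "moore_penrose (DF F x0)"
  have sm: "smooth F" by (rule real_analytic_imp_smooth[OF an])
  have bl: "bounded_linear (\<lambda>y. ?A y \<bullet> w)"
    using linear_DF_inverse[OF an sj] bounded_linear_compose[OF bounded_linear_inner_left]
    by (auto simp: linear_conv_bounded_linear)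
  have \<gamma>: "0 \<le> ?\<gamma>" by (rule gamma_F_nonneg[OF an sj])
  define q where "q = ?\<gamma> * norm h"
  have q: "0 \<le> q" "q < 1" unfolding q_def using \<gamma> h by auto
  \<comment> \<open>This radius exceeds 1, so \<open>t = 1\<close> is an interior point, while
    \<open>q * \<rho>\<close> stays below 1, also when \<open>q = 0\<close>.\<close>
  define \<rho> where "\<rho> = 2 / (1 + q)"
  have \<rho>: "1 < \<rho>" "q * \<rho> < 1" unfolding \<rho>_def using q by (auto simp: field_simps)
  define f where "f = (\<lambda>t. ?A (F (x0 + t *\<^sub>R h)) \<bullet> w)"
  define a where "a = (\<lambda>t k. ?A (taylor_coeff F (x0 + t *\<^sub>R h) k (replicate k h)) \<bullet> w)"
  have loc: "\<exists>r>0. \<forall>s. \<bar>s - t\<bar> < r \<longrightarrow> (\<lambda>k. a t k * (s - t) ^ k) sums f s" for t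
  proof -
    obtain r where r: "r > 0" "\<And>u. norm u < r \<Longrightarrow>
      (\<lambda>k. taylor_coeff F (x0 + t *\<^sub>R h) k (replicate k u)) sums F (x0 + t *\<^sub>R h + u)"
      using an unfolding real_analytic_def by blast
    have "(\<lambda>k. a t k * (s - t) ^ k) sums f s" if s: "\<bar>s - t\<bar> < r / (norm h + 1)" for s
    proof -
      have nz: "norm h + 1 > 0" by (simp add: add_nonneg_pos)
      have "\<bar>s - t\<bar> * norm h \<le> \<bar>s - t\<bar> * (norm h + 1)" by (simp add: mult_left_mono)
      also have "\<dots> < r" using s nz by (simp add: pos_less_divide_eq)
      finally have "norm ((s - t) *\<^sub>R h) < r" by simp
      from bounded_linear.sums[OF bl r(2)[OF this]]
      have "(\<lambda>k. ?A (taylor_coeff F (x0 + t *\<^sub>R h) k (replicate k ((s - t) *\<^sub>R h))) \<bullet> w) sums f s"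
        by (simp add: f_def algebra_simps)
      moreover have "?A (taylor_coeff F (x0 + t *\<^sub>R h) k (replicate k ((s - t) *\<^sub>R h))) \<bullet> w = a t k * (s - t) ^ k" for k
        unfolding a_def multilinear_replicate_scaleR[OF multilinear_taylor_coeff[OF sm]]
        by (simp add: linear_scale[OF linear_DF_inverse[OF an sj]])
      ultimately show ?thesis by simp
    qed
    moreover have "0 < r / (norm h + 1)" using r(1) by (simp add: add_nonneg_pos)
    ultimately show ?thesis by blast
  qed
  have a0: "a 0 k = newton_coeff F x0 k (replicate k h) \<bullet> w" for k
    unfolding a_def by (simp add: linear_scale[OF linear_DF_inverse[OF an sj]])
  have summ: "summable (\<lambda>k. a 0 k * s ^ k)" if s: "\<bar>s\<bar> < \<rho>" for s
  proof -
    \<comment> \<open>The index is shifted because \<gamma> gives no control of the constant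
      term.\<close>
    have "summable (\<lambda>k. a 0 (Suc k) * s ^ Suc k)"
    proof (rule summable_comparison_test')
      show "summable (\<lambda>k. norm w * norm h * \<rho> * (q * \<rho>) ^ k)"
        using q \<rho> by (intro summable_mult summable_geometric) auto
      fix k :: nat
      have "norm (a 0 (Suc k)) \<le> norm (newton_coeff F x0 (Suc k) (replicate (Suc k) h)) * norm w"
        unfolding a0 by (simp only: real_norm_def Cauchy_Schwarz_ineq2)
      also have "\<dots> \<le> (?\<gamma> ^ k * norm h ^ Suc k) * norm w"
        using norm_newton_coeff_le[OF an sj, of "Suc k" "replicate (Suc k) h"]
        by (intro mult_right_mono) (auto simp: prod_list_replicate)
      finally have "norm (a 0 (Suc k) * s ^ Suc k) \<le> (?\<gamma> ^ k * norm h ^ Suc k) * norm w * \<rho> ^ Suc k"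
        unfolding real_norm_def abs_mult power_abs
        using s \<gamma> by (intro mult_mono power_mono) auto
      then show "norm (a 0 (Suc k) * s ^ Suc k) \<le> norm w * norm h * \<rho> * (q * \<rho>) ^ k"
        by (simp add: q_def power_mult_distrib mult_ac)
    qed
    then show ?thesis by (subst (asm) summable_Suc_iff)
  qed
  obtain r0 where r0: "r0 > 0" "\<And>s. \<bar>s\<bar> < r0 \<Longrightarrow> (\<lambda>k. a 0 k * s ^ k) sums f s"
    using loc[of 0] by auto
  have "(\<lambda>k. a 0 k * 1 ^ k) sums f 1"
    by (rule real_analytic_identity[OF _ r0 summ]) (use loc \<rho> in \<open>blast | simp\<close>)+
  then show ?thesis unfolding a0 f_def by simp
qed

text \<open>In the difference of the two Taylor series the constant terms cancel and the linear
  terms are the subtracted part; the rest is majorized by the differentiated geometric series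
  without its leading 1. Choosing \<open>w\<close> as the remainder itself makes the scalar series
  sum to its squared norm, and one factor \<open>norm w\<close> cancels.\<close>

lemma norm_newton_remainder_diff_le:
  assumes \<rho>: "gamma_F F x0 * \<rho> < 1" and h: "norm h \<le> \<rho>" "norm h' \<le> \<rho>"
  shows "norm (moore_penrose (DF F x0) (F (x0 + h) - F (x0 + h') - DF F x0 (h - h')))
    \<le> (1 / (1 - gamma_F F x0 * \<rho>)\<^sup>2 - 1) * norm (h - h')"
proof -
  let ?\<gamma> = "gamma_F F x0" and ?A = "moore_penrose (DF F x0)"
  have sm: "smooth F" by (rule real_analytic_imp_smooth[OF an])
  note linA = linear_DF_inverse[OF an sj] and linD = linear_DF[OF sm, of x0]
  have \<gamma>: "0 \<le> ?\<gamma>" by (rule gamma_F_nonneg[OF an sj])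
  have \<rho>0: "0 \<le> \<rho>" using h(1) norm_ge_zero order_trans by blast
  define u where "u = ?\<gamma> * \<rho>"
  have u: "0 \<le> u" "u < 1" unfolding u_def using \<gamma> \<rho> \<rho>0 by auto
  have small: "?\<gamma> * norm h < 1" "?\<gamma> * norm h' < 1"
    using mult_left_mono[OF h(1) \<gamma>] mult_left_mono[OF h(2) \<gamma>] \<rho> by auto
  define w where "w = ?A (F (x0 + h) - F (x0 + h') - DF F x0 (h - h'))"
  define d where "d = (\<lambda>k. newton_coeff F x0 k (replicate k h) - newton_coeff F x0 k (replicate k h'))"
  have "(\<lambda>k. d k \<bullet> w) sums (?A (F (x0 + h) - F (x0 + h')) \<bullet> w)"
    using sums_diff[OF newton_coeff_sums[OF small(1)] newton_coeff_sums[OF small(2)]]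
    unfolding d_def by (simp add: inner_diff_left linear_diff[OF linA])
  moreover have "d 0 = 0" unfolding d_def by simp
  ultimately have "(\<lambda>k. d (Suc k) \<bullet> w) sums (?A (F (x0 + h) - F (x0 + h')) \<bullet> w)"
    using sums_Suc_iff[of "\<lambda>k. d k \<bullet> w"] by simp
  moreover have "d (Suc 0) = ?A (DF F x0 (h - h'))"
    unfolding d_def by (simp add: DF_eq_higher_deriv[symmetric] linear_diff[OF linA] linear_diff[OF linD]
        del: higher_deriv.simps)
  ultimately have s: "(\<lambda>k. d (Suc k) \<bullet> w - (if k = 0 then d (Suc k) \<bullet> w else 0)) sums (w \<bullet> w)"
    using sums_diff[OF _ sums_single[of 0 "\<lambda>k. d (Suc k) \<bullet> w"]]
    unfolding w_def by (simp add: linear_diff[OF linA] inner_diff_left)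
  have e: "(\<lambda>k. (real (Suc k) * u ^ k - (if k = 0 then 1 else 0)) * (norm (h - h') * norm w))
    sums ((1 / (1 - u)\<^sup>2 - 1) * (norm (h - h') * norm w))"
    by (intro sums_mult2 sums_diff sums_single) (use geometric_deriv_sums[of u] u in simp)
  have bound: "norm (d (Suc k) \<bullet> w - (if k = 0 then d (Suc k) \<bullet> w else 0))
    \<le> (real (Suc k) * u ^ k - (if k = 0 then 1 else 0)) * (norm (h - h') * norm w)" for k
  proof (cases "k = 0")
    case False
    have "norm (d (Suc k)) \<le> ?\<gamma> ^ k * (real (Suc k) * \<rho> ^ (Suc k - 1)) * norm (h - h')"
      unfolding d_def
      by (rule multilinear_diagonal_lipschitz[OF multilinear_newton_coeff[OF an sj]])
        (use \<gamma> h norm_newton_coeff_le[OF an sj, of "Suc k"] in auto)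
    then have "norm (d (Suc k)) * norm w \<le> (?\<gamma> ^ k * (real (Suc k) * \<rho> ^ (Suc k - 1)) * norm (h - h')) * norm w"
      by (rule mult_right_mono) simp
    then have "norm (d (Suc k) \<bullet> w) \<le> (?\<gamma> ^ k * (real (Suc k) * \<rho> ^ (Suc k - 1)) * norm (h - h')) * norm w"
      using Cauchy_Schwarz_ineq2[of "d (Suc k)" w] by (simp only: real_norm_def)
    then show ?thesis using False by (simp add: u_def power_mult_distrib mult_ac)
  qed simp
  have "norm (w \<bullet> w) \<le> (1 / (1 - u)\<^sup>2 - 1) * (norm (h - h') * norm w)"
    using norm_suminf_le[OF bound sums_summable[OF e]] sums_unique[OF s] sums_unique[OF e] by simp
  then have "norm w * norm w \<le> ((1 / (1 - u)\<^sup>2 - 1) * norm (h - h')) * norm w"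
    by (simp add: power2_norm_eq_inner[symmetric] power2_eq_square mult_ac)
  moreover have "0 \<le> 1 / (1 - u)\<^sup>2 - 1"
    using u by (simp add: power_le_one)
  ultimately have "norm w \<le> (1 / (1 - u)\<^sup>2 - 1) * norm (h - h')"
    by (cases "norm w = 0") auto
  then show ?thesis unfolding w_def u_def .
qed

lemma norm_newton_derivative_diff_le:
  assumes \<rho>: "gamma_F F x0 * \<rho> < 1" and x: "x \<in> ball x0 \<rho>"
  shows "norm (moore_penrose (DF F x0) (DF F x v - DF F x0 v)) \<le> (1 / (1 - gamma_F F x0 * \<rho>)\<^sup>2 - 1) * norm v"
proof -
  let ?A = "moore_penrose (DF F x0)"
  have sm: "smooth F" by (rule real_analytic_imp_smooth[OF an])
  note linA = linear_DF_inverse[OF an sj] and linD = linear_DF[OF sm, of x0]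
  show ?thesis
  proof (rule lipschitz_imp_norm_derivative_le[OF _ open_ball x])
    have "((\<lambda>y. F y - DF F x0 y) has_derivative (\<lambda>v. DF F x v - DF F x0 v)) (at x)"
      by (rule has_derivative_diff[OF DF_has_derivative[OF sm] linear_imp_has_derivative[OF linD]])
    then show "((\<lambda>y. ?A (F y - DF F x0 y)) has_derivative (\<lambda>v. ?A (DF F x v - DF F x0 v))) (at x)"
      by (rule bounded_linear.has_derivative[OF linA[unfolded linear_conv_bounded_linear]])
    fix y z assume "y \<in> ball x0 \<rho>" "z \<in> ball x0 \<rho>"
    then have le: "norm (?A (F y - F z - DF F x0 (y - z))) \<le> (1 / (1 - gamma_F F x0 * \<rho>)\<^sup>2 - 1) * norm (y - z)"
      using norm_newton_remainder_diff_le[OF \<rho>, of "y - x0" "z - x0"]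
      by (simp add: dist_norm norm_minus_commute)
    have "?A (F y - DF F x0 y) - ?A (F z - DF F x0 z) = ?A (F y - F z - DF F x0 (y - z))"
      by (simp add: linear_diff[OF linA] linear_diff[OF linD])
    with le show "norm (?A (F y - DF F x0 y) - ?A (F z - DF F x0 z)) \<le> (1 / (1 - gamma_F F x0 * \<rho>)\<^sup>2 - 1) * norm (y - z)"
      by simp
  qed
qed

end

section \<open>Existence for Lipschitz vector fields\<close>

text \<open>Picard iteration contracts the sup norm with weight \<open>exp (- 2 K t)\<close> by a factor 2, so that no
  subdivision of the interval is necessary.\<close>
lemma lipschitz_autonomous_ode_solution:
  fixes V :: "'a::euclidean_space \<Rightarrow> 'a"
  assumes lip: "\<And>x y. norm (V x - V y) \<le> K * norm (x - y)" and K: "0 < K"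
  shows "\<exists>y. y 0 = x0 \<and> (\<forall>t\<in>{0..1}. (y has_vector_derivative V (y t)) (at t within {0..1}))"
proof -
  \<comment> \<open>Clamping time to the unit interval makes each iterate a bounded continuous
    function on the whole line, so the fixed point theorem applies in the complete space of such
    functions.\<close>
  define c where "c = (\<lambda>t::real. max 0 (min 1 t))"
  have c01: "c t \<in> {0..1}" for t unfolding c_def by auto
  have cc: "continuous_on UNIV c" unfolding c_def by (intro continuous_intros)
  \<comment> \<open>The unknown \<open>g\<close> is the displacement from \<open>x0\<close>
    multiplied by \<open>exp (- (2 * K * s))\<close>; the weighted norm thus becomes the plain sup
    norm of \<open>g\<close>.\<close>
  define f where "f = (\<lambda>(g :: real \<Rightarrow>\<^sub>C 'a) s. V (x0 + exp (2 * K * s) *\<^sub>R g s))"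
  have contV: "continuous_on UNIV V"
    by (rule lipschitz_on_continuous_on[of K])
      (use lip K in \<open>auto simp: lipschitz_on_def dist_norm\<close>)
  have contf: "continuous_on S (f g)" for g S
    unfolding f_def
    by (rule continuous_on_compose2[OF contV]) (auto intro!: continuous_intros)
  have intf: "f g integrable_on {0..u}" for g u
    by (rule integrable_continuous_real[OF contf])
  define h where "h = (\<lambda>g u. exp (- (2 * K * u)) *\<^sub>R integral {0..u} (f g))"
  have conth: "continuous_on {0..1} (h g)" for g
    unfolding h_def by (intro continuous_intros indefinite_integral_continuous_1 intf)
  have bc: "(\<lambda>t. h g (c t)) \<in> bcontfun" for g
  proof -
    have "continuous_on UNIV (\<lambda>t. h g (c t))"
      by (rule continuous_on_compose2[OF conth cc]) (use c01 in auto)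
    moreover have "bounded (h g ` {0..1})"
      by (intro compact_imp_bounded compact_continuous_image conth) simp
    then have "bounded (range (\<lambda>t. h g (c t)))"
      by (rule bounded_subset) (use c01 in auto)
    ultimately show ?thesis by (simp add: bcontfun_def)
  qed
  define \<Phi> where "\<Phi> = (\<lambda>g. Bcontfun (\<lambda>t. h g (c t)))"
  have \<Phi>: "apply_bcontfun (\<Phi> g) t = h g (c t)" for g t
    unfolding \<Phi>_def using Bcontfun_inverse[OF bc] by simp
  have exp_int: "((\<lambda>s. M * exp (2 * K * s)) has_integral (M * exp (2 * K * u) / (2 * K) - M * exp (2 * K * 0) / (2 * K))) {0..u}"
    if "0 \<le> u" for u M
    by (rule fundamental_theorem_of_calculus[OF that])
      (use K in \<open>auto intro!: derivative_eq_intros simp: has_real_derivative_iff_has_vector_derivative[symmetric]\<close>)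
  have contr: "dist (\<Phi> g) (\<Phi> k) \<le> 1 / 2 * dist g k" for g k
  proof (rule dist_bound)
    fix t
    define u where "u = c t"
    have u: "0 \<le> u" using c01[of t] unfolding u_def by simp
    have "norm (integral {0..u} (f g) - integral {0..u} (f k)) = norm (integral {0..u} (\<lambda>s. f g s - f k s))"
      by (simp add: integral_diff intf)
    also have "\<dots> \<le> integral {0..u} (\<lambda>s. (K * dist g k) * exp (2 * K * s))"
    proof (rule integral_norm_bound_integral)
      show "(\<lambda>s. f g s - f k s) integrable_on {0..u}" by (intro integrable_diff intf)
      show "(\<lambda>s. (K * dist g k) * exp (2 * K * s)) integrable_on {0..u}"
        using exp_int[OF u] by blast
      fix s
      have "norm (f g s - f k s) \<le> K * norm (exp (2 * K * s) *\<^sub>R g s - exp (2 * K * s) *\<^sub>R k s)"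
        unfolding f_def using lip[of "x0 + exp (2 * K * s) *\<^sub>R g s" "x0 + exp (2 * K * s) *\<^sub>R k s"] by simp
      also have "\<dots> = K * (exp (2 * K * s) * dist (g s) (k s))"
        by (simp add: scaleR_diff_right[symmetric] dist_norm)
      also have "\<dots> \<le> K * (exp (2 * K * s) * dist g k)"
        using K dist_bounded[of g s k] by (intro mult_left_mono) auto
      finally show "norm (f g s - f k s) \<le> (K * dist g k) * exp (2 * K * s)" by (simp add: mult_ac)
    qed
    also have "\<dots> = (K * dist g k) * exp (2 * K * u) / (2 * K) - (K * dist g k) * exp (2 * K * 0) / (2 * K)"
      by (rule integral_unique[OF exp_int[OF u]])
    also have "\<dots> \<le> 1 / 2 * dist g k * exp (2 * K * u)" using K by simp
    finally have *: "norm (integral {0..u} (f g) - integral {0..u} (f k)) \<le> 1 / 2 * dist g k * exp (2 * K * u)" .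
    have "dist (\<Phi> g t) (\<Phi> k t) = exp (- (2 * K * u)) * norm (integral {0..u} (f g) - integral {0..u} (f k))"
      unfolding \<Phi> h_def u_def[symmetric] by (simp add: dist_norm scaleR_diff_right[symmetric])
    also have "\<dots> \<le> exp (- (2 * K * u)) * (1 / 2 * dist g k * exp (2 * K * u))"
      by (rule mult_left_mono[OF *]) simp
    also have "\<dots> = 1 / 2 * dist g k" by (simp add: exp_minus field_simps)
    finally show "dist (\<Phi> g t) (\<Phi> k t) \<le> 1 / 2 * dist g k" .
  qed
  obtain g where g: "\<Phi> g = g"
    using banach_fix_type[of "1/2" \<Phi>] contr by auto
  define y where "y = (\<lambda>t. x0 + exp (2 * K * t) *\<^sub>R g t)"
  have fy: "f g s = V (y s)" for s unfolding f_def y_def by simp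
  have y: "y t = x0 + integral {0..t} (f g)" if "t \<in> {0..1}" for t
  proof -
    have "c t = t" using that unfolding c_def by auto
    then have "g t = exp (- (2 * K * t)) *\<^sub>R integral {0..t} (f g)"
      using \<Phi>[of g t] unfolding g h_def by simp
    then show ?thesis unfolding y_def by (simp add: exp_minus)
  qed
  show ?thesis
  proof (intro exI[of _ y] conjI ballI)
    show "y 0 = x0" using y[of 0] by simp
    fix t :: real assume t: "t \<in> {0..1}"
    have "((\<lambda>t. x0 + integral {0..t} (f g)) has_vector_derivative 0 + f g t) (at t within {0..1})"
      by (intro has_vector_derivative_add integral_has_vector_derivative contf t has_vector_derivative_const)
    then show "(y has_vector_derivative V (y t)) (at t within {0..1})"
      unfolding fy[of t, symmetric]
      by (intro has_vector_derivative_transform[OF t y]) auto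
  qed
qed

section \<open>Perturbation and flow estimates\<close>

text \<open>If \<open>M (A y) = 0\<close>, then \<open>A y\<close> is the negative of
  \<open>A ((M - L) (A y))\<close>, hence of norm at most \<open>c * norm (A y)\<close>, and
  vanishes. So \<open>M \<circ> A\<close> is injective and, by dimension, surjective. The preimage
  \<open>z = A y'\<close> of \<open>y\<close> under \<open>M\<close> obeys the asserted bound, and
  the pseudoinverse of \<open>M\<close> gives nothing longer.\<close>

lemma perturbed_surjective:
  fixes L M :: "'a::euclidean_space \<Rightarrow> 'b::euclidean_space"
  assumes L: "linear L" "surj L" and M: "linear M" and c: "c < 1"
    and d: "\<And>v. norm (moore_penrose L (M v - L v)) \<le> c * norm v"
  shows "surj M" and "norm (moore_penrose M y) \<le> norm (moore_penrose L y) / (1 - c)"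
proof -
  let ?A = "moore_penrose L"
  note linA = linear_moore_penrose[OF L] and LA = moore_penrose_right_inverse[OF L]
  have linT: "linear (\<lambda>y. M (?A y))" using linear_compose[OF linA M] by (simp add: o_def)
  have "inj (\<lambda>y. M (?A y))"
    unfolding linear_injective_0[OF linT]
  proof (intro allI impI)
    fix y assume "M (?A y) = 0"
    then have "norm (?A y) \<le> c * norm (?A y)"
      using d[of "?A y"] by (simp add: LA linear_neg[OF linA])
    moreover have "c * norm (?A y) < norm (?A y)" if "?A y \<noteq> 0" using that c by simp
    ultimately have "?A y = 0" by fastforce
    then show "y = 0" using LA[of y] linear_0[OF L(1)] by simp
  qed
  then have T: "surj (\<lambda>y. M (?A y))" by (rule linear_inj_imp_surj[OF linT])
  then show sM: "surj M" unfolding surj_def by blast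
  obtain y' where y': "y = M (?A y')" using T by (metis surjD)
  define z where "z = ?A y'"
  have "?A (M z - L z) = ?A y - z" unfolding z_def y' by (simp add: LA linear_diff[OF linA])
  then have "norm z \<le> norm (?A y) + c * norm z"
    using d[of z] norm_triangle_ineq4[of "?A y" "?A y - z"] by simp
  then have "norm z * (1 - c) \<le> norm (?A y)" by (simp add: algebra_simps)
  then have "norm z \<le> norm (?A y) / (1 - c)" using c by (simp add: pos_le_divide_eq)
  moreover have "norm (moore_penrose M y) \<le> norm z"
    using norm_moore_penrose_projection_le[OF M sM, of z] unfolding z_def y' .
  ultimately show "norm (moore_penrose M y) \<le> norm (?A y) / (1 - c)" by simp
qed

text \<open>Continuity of the derivative is known for each fixed direction only; the finitely many
  basis directions then control its operator norm.\<close>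

lemma continuously_differentiable_lipschitz_on_compact:
  fixes g :: "'a::euclidean_space \<Rightarrow> 'b::real_normed_vector"
  assumes C: "compact C" "convex C"
    and d: "\<And>y. g differentiable (at y)"
    and cont: "\<And>h. continuous_on C (\<lambda>y. frechet_derivative g (at y) h)"
  shows "\<exists>M\<ge>0. \<forall>x\<in>C. \<forall>y\<in>C. norm (g x - g y) \<le> M * norm (x - y)"
proof -
  have "\<exists>K\<ge>0. \<forall>y\<in>C. norm (frechet_derivative g (at y) h) \<le> K" for h
  proof -
    have "bounded ((\<lambda>y. frechet_derivative g (at y) h) ` C)"
      by (intro compact_imp_bounded compact_continuous_image cont C)
    then show ?thesis unfolding bounded_pos by (auto intro: less_imp_le)
  qed
  then obtain K where K: "\<And>h. K h \<ge> 0" "\<And>h y. y \<in> C \<Longrightarrow> norm (frechet_derivative g (at y) h) \<le> K h"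
    by metis
  let ?M = "\<Sum>b\<in>Basis. K b"
  have "norm (g x - g y) \<le> ?M * norm (x - y)" if xy: "x \<in> C" "y \<in> C" for x y
  proof (rule differentiable_bound[OF C(2) _ _ xy])
    show "(g has_derivative frechet_derivative g (at z)) (at z within C)" for z
      using d[of z] by (simp add: frechet_derivative_works has_derivative_at_withinI)
    show "onorm (frechet_derivative g (at z)) \<le> ?M" if z: "z \<in> C" for z
    proof (rule onorm_bound)
      have lin: "linear (frechet_derivative g (at z))" by (rule linear_frechet_derivative[OF d])
      fix h
      have "frechet_derivative g (at z) h = frechet_derivative g (at z) (\<Sum>b\<in>Basis. (h \<bullet> b) *\<^sub>R b)"
        by (simp add: euclidean_representation)
      also have "\<dots> = (\<Sum>b\<in>Basis. (h \<bullet> b) *\<^sub>R frechet_derivative g (at z) b)"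
        by (simp add: linear_sum[OF lin] linear_scale[OF lin])
      also have "norm \<dots> \<le> (\<Sum>b\<in>Basis. norm h * K b)"
        by (rule sum_norm_le) (use K(2)[OF z] in \<open>auto intro!: mult_mono Basis_le_norm\<close>)
      also have "\<dots> = ?M * norm h" by (simp add: sum_distrib_left mult.commute)
      finally show "norm (frechet_derivative g (at z) h) \<le> ?M * norm h" .
    qed (use K(1) in \<open>auto intro: sum_nonneg\<close>)
  qed
  then show ?thesis using K(1) by (intro exI[of _ ?M]) (auto intro: sum_nonneg)
qed

lemma DF_lipschitz_on_compact:
  fixes F :: "'a::euclidean_space \<Rightarrow> 'b::euclidean_space"
  assumes sm: "smooth F" and C: "compact C" "convex C"
  shows "\<exists>M\<ge>0. \<forall>x\<in>C. \<forall>y\<in>C. \<forall>v. norm (DF F x v - DF F y v) \<le> M * norm (x - y) * norm v"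
proof -
  have "\<exists>M\<ge>0. \<forall>x\<in>C. \<forall>y\<in>C. norm (DF F x b - DF F y b) \<le> M * norm (x - y)" for b
  proof (rule continuously_differentiable_lipschitz_on_compact[OF C])
    show "(\<lambda>y. DF F y b) differentiable (at y)" for y
      unfolding DF_eq_higher_deriv by (rule smooth_differentiable[OF sm])
    show "continuous_on C (\<lambda>y. frechet_derivative (\<lambda>y. DF F y b) (at y) h)" for h
    proof -
      have "(\<lambda>y. frechet_derivative (\<lambda>y. DF F y b) (at y) h) = (\<lambda>y. higher_deriv F (Suc (Suc 0)) y [h, b])"
        by (simp add: DF_def)
      then show ?thesis
        using smooth_differentiable[OF sm]
        by (metis differentiable_imp_continuous_within continuous_at_imp_continuous_on)
    qed
  qed
  then obtain M where M: "\<And>b. M b \<ge> 0"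
    "\<And>b x y. x \<in> C \<Longrightarrow> y \<in> C \<Longrightarrow> norm (DF F x b - DF F y b) \<le> M b * norm (x - y)"
    by metis
  let ?M = "\<Sum>b\<in>Basis. M b"
  have "norm (DF F x v - DF F y v) \<le> ?M * norm (x - y) * norm v" if xy: "x \<in> C" "y \<in> C" for x y v
  proof -
    have "DF F x v - DF F y v = DF F x (\<Sum>b\<in>Basis. (v \<bullet> b) *\<^sub>R b) - DF F y (\<Sum>b\<in>Basis. (v \<bullet> b) *\<^sub>R b)"
      by (simp add: euclidean_representation)
    also have "\<dots> = (\<Sum>b\<in>Basis. (v \<bullet> b) *\<^sub>R (DF F x b - DF F y b))"
      by (simp add: linear_sum[OF linear_DF[OF sm]] linear_scale[OF linear_DF[OF sm]]
          sum_subtractf scaleR_diff_right)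
    also have "norm \<dots> \<le> (\<Sum>b\<in>Basis. norm v * (M b * norm (x - y)))"
      by (rule sum_norm_le) (use M(2)[OF xy] in \<open>auto intro!: mult_mono Basis_le_norm\<close>)
    also have "\<dots> = ?M * norm (x - y) * norm v"
      by (simp add: sum_distrib_right sum_distrib_left mult_ac)
    finally show ?thesis .
  qed
  then show ?thesis using M(1) by (intro exI[of _ ?M]) (auto intro: sum_nonneg)
qed

text \<open>The speed bound is conditional on staying in the ball. Until the earliest exit time
  \<open>m\<close> it holds, so the distance at \<open>m\<close> is at most \<open>K\<close>, which
  is less than \<rho>: there is no exit.\<close>

lemma exponentially_decaying_velocity_bound:
  fixes x :: "real \<Rightarrow> 'a::real_normed_vector"
  assumes x': "\<And>t. 0 \<le> t \<Longrightarrow> (x has_vector_derivative x' t) (at t within {0..})"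
    and bound: "\<And>t. 0 \<le> t \<Longrightarrow> x t \<in> ball (x 0) \<rho> \<Longrightarrow> norm (x' t) \<le> K * exp (- t)"
    and K: "0 \<le> K" "K < \<rho>" and st: "0 \<le> s" "s \<le> t"
  shows "norm (x t - x s) \<le> K * (exp (- s) - exp (- t))"
proof -
  have cont: "continuous_on {0..} x"
    using x' by (meson atLeast_iff continuous_on_eq_continuous_within has_vector_derivative_continuous)
  \<comment> \<open>Membership in the ball is asked at interior times only, so that the estimate
    reaches the exit time, where \<open>x m\<close> is already outside the open ball.\<close>
  have step: "norm (x t - x s) \<le> K * (exp (- s) - exp (- t))"
    if st: "0 \<le> s" "s \<le> t" and inball: "\<And>u. s < u \<Longrightarrow> u < t \<Longrightarrow> x u \<in> ball (x 0) \<rho>" for s t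
  proof (cases "s = t")
    case False
    have "norm (x t - x s) \<le> - K * exp (- t) - - K * exp (- s)"
    proof (rule differentiable_bound_general)
      show "s < t" using st False by simp
      show "continuous_on {s..t} x" by (rule continuous_on_subset[OF cont]) (use st in auto)
      show "continuous_on {s..t} (\<lambda>u. - K * exp (- u))" by (intro continuous_intros)
      fix u assume u: "s < u" "u < t"
      have "at u within {0..} = at u" by (rule at_within_interior) (use u st in simp)
      then show "(x has_vector_derivative x' u) (at u)" using x'[of u] u st by simp
      show "((\<lambda>u. - K * exp (- u)) has_vector_derivative K * exp (- u)) (at u)"
        unfolding has_real_derivative_iff_has_vector_derivative[symmetric]
        by (auto intro!: derivative_eq_intros)
      show "norm (x' u) \<le> K * exp (- u)" by (rule bound) (use u st inball in auto)
    qed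
    then show ?thesis by (simp add: algebra_simps)
  qed simp
  have "x t \<in> ball (x 0) \<rho>" if "0 \<le> t" for t
  proof (rule ccontr)
    assume out: "x t \<notin> ball (x 0) \<rho>"
    define T where "T = {0..t} \<inter> {u. \<rho> \<le> dist (x 0) (x u)}"
    have contd: "continuous_on {0..t} (\<lambda>u. dist (x 0) (x u))"
      by (intro continuous_intros continuous_on_subset[OF cont]) auto
    have T_eq: "T = {0..t} \<inter> (\<lambda>u. dist (x 0) (x u)) -` {\<rho>..}" unfolding T_def by auto
    have "closed T" unfolding T_eq by (rule continuous_closed_preimage[OF contd]) auto
    moreover have "bounded T" by (rule bounded_subset[of "{0..t}"]) (auto simp: T_def)
    ultimately have "compact T" by (simp add: compact_eq_bounded_closed)
    moreover have "t \<in> T" unfolding T_def using out that by auto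
    then have "T \<noteq> {}" by blast
    ultimately have "\<exists>m\<in>T. \<forall>u\<in>T. m \<le> u" by (rule compact_attains_inf)
    then obtain m where m: "m \<in> T" "\<And>u. u \<in> T \<Longrightarrow> m \<le> u" by blast
    have "norm (x m - x 0) \<le> K * (exp (- 0) - exp (- m))"
    proof (rule step)
      fix u assume "0 < u" "u < m"
      then have "u \<notin> T" using m(2) by force
      then show "x u \<in> ball (x 0) \<rho>" using \<open>0 < u\<close> \<open>u < m\<close> m(1) unfolding T_def by auto
    qed (use m(1) T_def in auto)
    also have "\<dots> \<le> K" using K(1) by (simp add: mult_left_le)
    finally have "dist (x 0) (x m) < \<rho>" using K(2) by (simp add: dist_norm norm_minus_commute)
    then show False using m(1) unfolding T_def by simp
  qed
  then show ?thesis using step st by simp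
qed

text \<open>Increments after time \<open>s\<close> are at most \<open>K * exp (- s)\<close>. The
  limit is found along the integers, and the same estimate compares all real times with it.\<close>

lemma converges_of_exponentially_small_increments:
  fixes x :: "real \<Rightarrow> 'a::banach"
  assumes "\<And>s t. 0 \<le> s \<Longrightarrow> s \<le> t \<Longrightarrow> norm (x t - x s) \<le> K * (exp (- s) - exp (- t))" and K: "0 \<le> K"
  shows "\<exists>L. (x \<longlongrightarrow> L) at_top"
proof -
  have inc: "norm (x t - x s) \<le> K * exp (- s)" if "0 \<le> s" "s \<le> t" for s t
  proof -
    have "K * (exp (- s) - exp (- t)) \<le> K * exp (- s)" using K by (intro mult_left_mono) auto
    then show ?thesis using assms(1)[OF that] by simp
  qed
  have lim0: "((\<lambda>t. K * exp (- t)) \<longlongrightarrow> 0) at_top"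
    by (intro tendsto_mult_right_zero filterlim_compose[OF exp_at_bot filterlim_uminus_at_bot_at_top])
  have "Cauchy (\<lambda>n. x (real n))"
  proof (rule CauchyI')
    fix e :: real assume e: "0 < e"
    obtain M where M: "\<And>t. t \<ge> M \<Longrightarrow> K * exp (- t) < e"
      using order_tendstoD(2)[OF lim0 e] unfolding eventually_at_top_linorder by blast
    have "dist (x (real m)) (x (real n)) < e" if "m \<ge> nat \<lceil>M\<rceil>" "n > m" for m n
      using inc[of "real m" "real n"] M[of "real m"] that
      by (auto simp: dist_norm norm_minus_commute nat_ceiling_le_eq)
    then show "\<exists>M. \<forall>m\<ge>M. \<forall>n>m. dist (x (real m)) (x (real n)) < e" by blast
  qed
  then obtain L where L: "(\<lambda>n. x (real n)) \<longlonglongrightarrow> L" using Cauchy_convergent convergent_def by blast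
  have "norm (x t - L) \<le> K * exp (- t)" if "0 \<le> t" for t
  proof (rule tendsto_upperbound)
    show "(\<lambda>n. norm (x t - x (real n))) \<longlonglongrightarrow> norm (x t - L)" by (intro tendsto_intros L)
    have "norm (x t - x (real n)) \<le> K * exp (- t)" if "n \<ge> nat \<lceil>t\<rceil>" for n
      using inc[OF \<open>0 \<le> t\<close>, of "real n"] that by (simp add: norm_minus_commute nat_ceiling_le_eq)
    then show "\<forall>\<^sub>F n in sequentially. norm (x t - x (real n)) \<le> K * exp (- t)"
      unfolding eventually_sequentially by blast
  qed simp
  then have "\<forall>\<^sub>F t in at_top. norm (x t - L) \<le> K * exp (- t)"
    using eventually_ge_at_top[of 0] by (rule eventually_mono[rotated])
  then have "((\<lambda>t. x t - L) \<longlongrightarrow> 0) at_top" by (rule Lim_null_comparison[OF _ lim0])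
  then show ?thesis by (blast intro: LIM_zero_cancel)
qed

text \<open>A surjective \<open>DF F (x t)\<close> is a left inverse of its pseudoinverse, so
  \<open>F (x t)\<close> has derivative \<open>- F (x t)\<close> and
  \<open>exp t *\<^sub>R F (x t)\<close> is constant.\<close>

lemma newton_flow_residual:
  assumes sm: "smooth F" and sol: "newton_flow_sol F {0..} x" and t: "0 \<le> t"
  shows "F (x t) = exp (- t) *\<^sub>R F (x 0)"
proof -
  have "((\<lambda>t. exp t *\<^sub>R F (x t)) has_derivative (\<lambda>h. 0)) (at t within {0..})" if t: "t \<in> {0..}" for t
  proof -
    have s: "surj (DF F (x t))"
      and d: "(x has_vector_derivative - moore_penrose (DF F (x t)) (F (x t))) (at t within {0..})"
      using sol t unfolding newton_flow_sol_def by auto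
    note lin = linear_DF[OF sm]
    have "((\<lambda>t. F (x t)) has_vector_derivative DF F (x t) (- moore_penrose (DF F (x t)) (F (x t)))) (at t within {0..})"
      using vector_derivative_diff_chain_within[OF d has_derivative_at_withinI[OF DF_has_derivative[OF sm]]]
      by (simp add: o_def)
    also have "DF F (x t) (- moore_penrose (DF F (x t)) (F (x t))) = - F (x t)"
      by (simp add: linear_neg[OF lin] moore_penrose_right_inverse[OF lin s])
    finally have "((\<lambda>t. exp t *\<^sub>R F (x t)) has_vector_derivative exp t *\<^sub>R - F (x t) + exp t *\<^sub>R F (x t)) (at t within {0..})"
      by (intro has_vector_derivative_scaleR DERIV_subset[OF DERIV_exp]) auto
    then show ?thesis by (simp add: has_vector_derivative_def)
  qed
  from has_derivative_zero_constant[OF convex_real_interval(1) this]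
  obtain c where c: "\<And>t. t \<in> {0..} \<Longrightarrow> exp t *\<^sub>R F (x t) = c"
    by blast
  have "exp (- t) *\<^sub>R (exp t *\<^sub>R F (x t)) = exp (- t) *\<^sub>R F (x 0)" using c[of t] c[of 0] t by simp
  then show ?thesis by (simp add: exp_minus)
qed

section \<open>The flow under the smallness condition\<close>

context
  fixes F :: "'a::euclidean_space \<Rightarrow> 'b::euclidean_space" and x0 :: 'a
  assumes an: "real_analytic F" and sj: "surj (DF F x0)" and \<alpha>: "alpha_F F x0 < 1 / 13"
begin

text \<open>With \<open>u = \<gamma> \<rho> \<le> 2 / 13\<close> one has \<open>1 / (1 - u)\<^sup>2 - 1 \<le> 48 / 121 < 1 / 2\<close>; hence the velocity
  of the flow in the ball is at most \<open>121 / 73 < 2\<close> times \<open>\<beta>\<^sub>0 e\<^sup>-\<^sup>t\<close>.\<close>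
lemma newton_derivative_close_on_ball:
  obtains \<rho> where "2 * beta_F F x0 < \<rho>"
    and "\<And>x v. x \<in> ball x0 \<rho> \<Longrightarrow> norm (moore_penrose (DF F x0) (DF F x v - DF F x0 v)) \<le> 48 / 121 * norm v"
proof -
  let ?\<gamma> = "gamma_F F x0"
  have \<gamma>: "0 \<le> ?\<gamma>" by (rule gamma_F_nonneg[OF an sj])
  \<comment> \<open>For positive \<gamma>, \<open>2 * beta_F F x0 < 2 / (13 * ?\<gamma>)\<close> is
    exactly the hypothesis on \<open>alpha_F\<close>. For \<gamma> = 0 that quotient would be 0 by
    the division convention, and any radius above \<open>2 * beta_F F x0\<close> will do.\<close>
  define \<rho> where "\<rho> = (if ?\<gamma> = 0 then 2 * beta_F F x0 + 1 else 2 / (13 * ?\<gamma>))"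
  have 1: "2 * beta_F F x0 < \<rho>"
    using \<alpha> \<gamma> unfolding \<rho>_def alpha_F_def by (auto simp: field_simps)
  have u: "?\<gamma> * \<rho> \<le> 2 / 13" unfolding \<rho>_def by auto
  have "(11 / 13)\<^sup>2 \<le> (1 - ?\<gamma> * \<rho>)\<^sup>2" using u by (intro power_mono) auto
  moreover have "0 < (1 - ?\<gamma> * \<rho>)\<^sup>2" using u by (intro zero_less_power) simp
  ultimately have "1 / (1 - ?\<gamma> * \<rho>)\<^sup>2 \<le> 1 / (11 / 13)\<^sup>2"
    by (intro divide_left_mono mult_pos_pos) auto
  then have c: "1 / (1 - ?\<gamma> * \<rho>)\<^sup>2 - 1 \<le> 48 / 121" by (simp add: power2_eq_square)
  show thesis
  proof (rule that[OF 1])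
    fix x v assume x: "x \<in> ball x0 \<rho>"
    have "norm (moore_penrose (DF F x0) (DF F x v - DF F x0 v)) \<le> (1 / (1 - ?\<gamma> * \<rho>)\<^sup>2 - 1) * norm v"
      by (rule norm_newton_derivative_diff_le[OF an sj _ x]) (use u in simp)
    also have "\<dots> \<le> 48 / 121 * norm v" by (rule mult_right_mono[OF c]) simp
    finally show "norm (moore_penrose (DF F x0) (DF F x v - DF F x0 v)) \<le> 48 / 121 * norm v" .
  qed
qed

text \<open>The factor 121 / 73 is 1 / (1 - 48 / 121), from
  \<open>perturbed_surjective\<close>.\<close>

lemma pseudoinverse_bound_on_ball:
  obtains \<rho> where "2 * beta_F F x0 < \<rho>"
    and "\<And>x. x \<in> ball x0 \<rho> \<Longrightarrow> surj (DF F x)"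
    and "\<And>x y. x \<in> ball x0 \<rho> \<Longrightarrow>
      norm (moore_penrose (DF F x) y) \<le> 121 / 73 * norm (moore_penrose (DF F x0) y)"
proof -
  have sm: "smooth F" by (rule real_analytic_imp_smooth[OF an])
  obtain \<rho> where \<rho>: "2 * beta_F F x0 < \<rho>" "\<And>x v. x \<in> ball x0 \<rho> \<Longrightarrow>
    norm (moore_penrose (DF F x0) (DF F x v - DF F x0 v)) \<le> 48 / 121 * norm v"
    by (rule newton_derivative_close_on_ball) blast
  note P = perturbed_surjective[OF linear_DF[OF sm] sj linear_DF[OF sm], of "48 / 121", OF _ \<rho>(2)]
  show thesis
    by (rule that[OF \<rho>(1)]) (use P in \<open>auto simp: field_simps\<close>)
qed

lemma newton_flow_increment_bound:
  assumes sol: "newton_flow_sol F {0..} x" and x0: "x 0 = x0" and st: "0 \<le> s" "s \<le> t"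
  shows "norm (x t - x s) \<le> 121 / 73 * beta_F F x0 * (exp (- s) - exp (- t))"
proof -
  have sm: "smooth F" by (rule real_analytic_imp_smooth[OF an])
  have \<beta>: "0 \<le> beta_F F x0" by (simp add: beta_F_def)
  obtain \<rho> where \<rho>: "2 * beta_F F x0 < \<rho>" "\<And>x y. x \<in> ball x0 \<rho> \<Longrightarrow>
      norm (moore_penrose (DF F x) y) \<le> 121 / 73 * norm (moore_penrose (DF F x0) y)"
    by (rule pseudoinverse_bound_on_ball) blast
  show ?thesis
  proof (rule exponentially_decaying_velocity_bound[where \<rho> = \<rho> and
        x' = "\<lambda>t. - moore_penrose (DF F (x t)) (F (x t))"])
    fix t :: real assume t: "0 \<le> t"
    show "(x has_vector_derivative - moore_penrose (DF F (x t)) (F (x t))) (at t within {0..})"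
      using sol t unfolding newton_flow_sol_def by auto
    assume "x t \<in> ball (x 0) \<rho>"
    then have "norm (moore_penrose (DF F (x t)) (F (x t))) \<le> 121 / 73 * norm (moore_penrose (DF F x0) (F (x t)))"
      unfolding x0 by (rule \<rho>(2))
    also have "F (x t) = exp (- t) *\<^sub>R F x0" using newton_flow_residual[OF sm sol t] x0 by simp
    also have "norm (moore_penrose (DF F x0) (exp (- t) *\<^sub>R F x0)) = beta_F F x0 * exp (- t)"
      by (simp add: linear_scale[OF linear_DF_inverse[OF an sj]] beta_F_def)
    finally show "norm (- moore_penrose (DF F (x t)) (F (x t))) \<le> 121 / 73 * beta_F F x0 * exp (- t)"
      using \<open>F (x t) = exp (- t) *\<^sub>R F x0\<close> by simp
  qed (use \<rho>(1) \<beta> st in auto)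
qed

text \<open>In the time variable \<open>s = 1 - e\<^sup>-\<^sup>t\<close> the flow becomes \<open>y' = - DF(y)\<^sup>\<dagger> F(x\<^sub>0)\<close>, whose solution is
  needed on the unit interval only; with speed at most \<open>2 \<beta>\<^sub>0\<close> it stays in the ball of radius \<open>2 \<beta>\<^sub>0\<close>.\<close>
lemma newton_flow_exists: "\<exists>x. x 0 = x0 \<and> newton_flow_sol F {0..} x"
proof -
  have sm: "smooth F" by (rule real_analytic_imp_smooth[OF an])
  have \<beta>: "0 \<le> beta_F F x0" by (simp add: beta_F_def)
  obtain \<rho> where \<rho>: "2 * beta_F F x0 < \<rho>" "\<And>x. x \<in> ball x0 \<rho> \<Longrightarrow> surj (DF F x)"
    "\<And>x y. x \<in> ball x0 \<rho> \<Longrightarrow>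
      norm (moore_penrose (DF F x) y) \<le> 121 / 73 * norm (moore_penrose (DF F x0) y)"
    by (rule pseudoinverse_bound_on_ball) blast
  define C where "C = cball x0 (2 * beta_F F x0)"
  have C: "compact C" "convex C" "closed C" "C \<noteq> {}" unfolding C_def using \<beta> by auto
  have Cball: "x \<in> ball x0 \<rho>" if "x \<in> C" for x using that \<rho>(1) unfolding C_def by auto
  obtain M where M: "M \<ge> 0" "\<And>x y v. x \<in> C \<Longrightarrow> y \<in> C \<Longrightarrow> norm (DF F x v - DF F y v) \<le> M * norm (x - y) * norm v"
    using DF_lipschitz_on_compact[OF sm C(1,2)] by blast
  obtain b where b: "b > 0" "\<And>y. norm (moore_penrose (DF F x0) y) \<le> b * norm y"
    using linear_bounded_pos[OF linear_DF_inverse[OF an sj]] by blast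
  define k where "k = 121 / 73 * b"
  have k: "0 \<le> k" unfolding k_def using b by simp
  have bk: "norm (moore_penrose (DF F x) y) \<le> k * norm y" if "x \<in> C" for x y
    using \<rho>(3)[OF Cball[OF that], of y] b(2)[of y] unfolding k_def by simp
  define W where "W = (\<lambda>x. - moore_penrose (DF F x) (F x0))"
  \<comment> \<open>The summand 1 makes \<open>K\<close> positive, as the existence lemma demands,
    even if \<open>F x0 = 0\<close> or \<open>M = 0\<close>.\<close>
  define K where "K = 2 * k\<^sup>2 * M * norm (F x0) + 1"
  have K: "0 < K" unfolding K_def using M(1) by (simp add: add_nonneg_pos)
  have lipW: "norm (W x - W y) \<le> K * norm (x - y)" if xy: "x \<in> C" "y \<in> C" for x y
  proof -
    have "norm (moore_penrose (DF F y) (F x0) - moore_penrose (DF F x) (F x0))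
      \<le> 2 * k\<^sup>2 * (M * norm (y - x)) * norm (F x0)"
      by (rule norm_moore_penrose_diff_le[OF linear_DF[OF sm] \<rho>(2)[OF Cball[OF xy(2)]]
          linear_DF[OF sm] \<rho>(2)[OF Cball[OF xy(1)]]])
        (use xy M k bk in auto)
    then have "norm (W x - W y) \<le> (2 * k\<^sup>2 * M * norm (F x0)) * norm (x - y)"
      unfolding W_def by (simp add: norm_minus_commute mult_ac)
    also have "\<dots> \<le> K * norm (x - y)" unfolding K_def by (intro mult_right_mono) auto
    finally show ?thesis .
  qed
  \<comment> \<open>Composing with the nearest-point projection onto \<open>C\<close>, which is
    1-Lipschitz, extends \<open>W\<close> to a globally Lipschitz field. The solution of the
    extended equation remains in \<open>C\<close>, where the fields agree.\<close>
  define V where "V = (\<lambda>x. W (closest_point C x))"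
  have cpC: "closest_point C x \<in> C" for x by (rule closest_point_in_set[OF C(3,4)])
  have lipV: "norm (V x - V y) \<le> K * norm (x - y)" for x y
  proof -
    have "norm (V x - V y) \<le> K * norm (closest_point C x - closest_point C y)"
      unfolding V_def by (rule lipW[OF cpC cpC])
    also have "\<dots> \<le> K * norm (x - y)"
      using closest_point_lipschitz[OF C(2-4), of x y] K unfolding dist_norm by (intro mult_left_mono) auto
    finally show ?thesis .
  qed
  have V: "norm (V x) \<le> 2 * beta_F F x0" for x
  proof -
    have "norm (V x) \<le> 121 / 73 * beta_F F x0"
      using \<rho>(3)[OF Cball[OF cpC[of x]], of "F x0"] unfolding V_def W_def beta_F_def by simp
    then show ?thesis using \<beta> by simp
  qed
  obtain y where y: "y 0 = x0" "\<And>t. t \<in> {0..1} \<Longrightarrow> (y has_vector_derivative V (y t)) (at t within {0..1})"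
    using lipschitz_autonomous_ode_solution[OF lipV K] by blast
  have yC: "y t \<in> C" if t: "t \<in> {0..1}" for t
  proof -
    have "norm (y t - y 0) \<le> 2 * beta_F F x0 * norm (t - 0)"
    proof (rule differentiable_bound[OF convex_real_interval(5) _ _ t])
      show "(y has_derivative (\<lambda>h. h *\<^sub>R V (y s))) (at s within {0..1})" if "s \<in> {0..1}" for s
        using y(2)[OF that] by (simp add: has_vector_derivative_def)
      show "onorm (\<lambda>h. h *\<^sub>R V (y s)) \<le> 2 * beta_F F x0" for s
        by (rule onorm_bound) (use V[of "y s"] \<beta> in \<open>auto simp: mult.commute intro: mult_left_mono\<close>)
    qed simp
    also have "\<dots> \<le> 2 * beta_F F x0" using t \<beta> by (simp add: mult_left_le)
    finally show ?thesis unfolding C_def using y(1) by (simp add: dist_norm norm_minus_commute)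
  qed
  have y': "(y has_vector_derivative W (y t)) (at t within {0..1})" if "t \<in> {0..1}" for t
    using y(2)[OF that] closest_point_self[OF yC[OF that]] unfolding V_def by simp
  \<comment> \<open>In the new time the residual has the constant derivative \<open>- F x0\<close>,
    so it decreases linearly and reaches 0 at time 1.\<close>
  have Fy: "F (y t) = (1 - t) *\<^sub>R F x0" if t: "t \<in> {0..1}" for t
  proof -
    have "((\<lambda>t. F (y t) + t *\<^sub>R F x0) has_derivative (\<lambda>h. 0)) (at t within {0..1})" if t: "t \<in> {0..1}" for t
    proof -
      note lin = linear_DF[OF sm] and s = \<rho>(2)[OF Cball[OF yC[OF t]]]
      have "((\<lambda>t. F (y t)) has_vector_derivative DF F (y t) (W (y t))) (at t within {0..1})"
        using vector_derivative_diff_chain_within[OF y'[OF t] has_derivative_at_withinI[OF DF_has_derivative[OF sm]]]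
        by (simp add: o_def)
      also have "DF F (y t) (W (y t)) = - F x0"
        unfolding W_def by (simp add: linear_neg[OF lin] moore_penrose_right_inverse[OF lin s])
      finally have "((\<lambda>t. F (y t) + t *\<^sub>R F x0) has_vector_derivative - F x0 + F x0) (at t within {0..1})"
        by (rule has_vector_derivative_add) (auto intro!: derivative_eq_intros simp: has_vector_derivative_def)
      then show ?thesis by (simp add: has_vector_derivative_def)
    qed
    from has_derivative_zero_constant[OF convex_real_interval(5) this]
    obtain c where c: "\<And>t. t \<in> {0..1} \<Longrightarrow> F (y t) + t *\<^sub>R F x0 = c"
      by blast
    then show ?thesis using c[of 0] c[OF t] y(1) by (simp add: scaleR_diff_left eq_diff_eq)
  qed
  define x where "x = (\<lambda>t. y (1 - exp (- t)))"
  have "newton_flow_sol F {0..} x"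
    unfolding newton_flow_sol_def
  proof (intro ballI conjI)
    fix t :: real assume t: "t \<in> {0..}"
    have s01: "1 - exp (- t) \<in> {0..1}" if "t \<in> {0..}" for t :: real using that by auto
    show s: "surj (DF F (x t))" unfolding x_def by (rule \<rho>(2)[OF Cball[OF yC[OF s01[OF t]]]])
    have "((\<lambda>t. 1 - exp (- t)) has_vector_derivative exp (- t)) (at t within {0..})"
      unfolding has_real_derivative_iff_has_vector_derivative[symmetric]
      by (auto intro!: derivative_eq_intros)
    \<comment> \<open>\<open>y\<close> is known to be differentiable only within the unit interval,
      which contains the image of the half-line under the time change.\<close>
    moreover have "(y has_vector_derivative W (y (1 - exp (- t)))) (at (1 - exp (- t)) within (\<lambda>t. 1 - exp (- t)) ` {0..})"
      by (rule has_vector_derivative_within_subset[OF y'[OF s01[OF t]]]) (use s01 in auto)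
    ultimately have "(x has_vector_derivative exp (- t) *\<^sub>R W (x t)) (at t within {0..})"
      unfolding x_def using vector_diff_chain_within by (fastforce simp: o_def)
    \<comment> \<open>The chain rule factor \<open>exp (- t)\<close> equals the decay of the
      residual, so linearity moves it inside the pseudoinverse and restores the original
      equation.\<close>
    also have "exp (- t) *\<^sub>R W (x t) = - moore_penrose (DF F (x t)) (F (x t))"
    proof -
      have "F (x t) = exp (- t) *\<^sub>R F x0" unfolding x_def using Fy[OF s01[OF t]] by simp
      then show ?thesis
        unfolding W_def by (simp add: linear_scale[OF linear_moore_penrose[OF linear_DF[OF sm] s]])
    qed
    finally show "(x has_vector_derivative - moore_penrose (DF F (x t)) (F (x t))) (at t within {0..})" .
  qed
  moreover have "x 0 = x0" unfolding x_def using y(1) by simp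
  ultimately show ?thesis by blast
qed

end

theorem theorem3p1:
  fixes F :: "'a::euclidean_space \<Rightarrow> real ^ 'm"
    and x0 :: 'a
  assumes "real_analytic F"
    and "CARD('m) \<le> DIM('a)"
    and "surj (DF F x0)"
    and "alpha_F F x0 < 1 / 13"
  shows "(\<exists>x. x 0 = x0 \<and> newton_flow_sol F {0..} x)
    \<and> (\<forall>x. x 0 = x0 \<and> newton_flow_sol F {0..} x \<longrightarrow>
         (\<forall>t\<ge>0. F (x t) = exp (- t) *\<^sub>R F x0)
       \<and> (\<forall>t\<ge>0. norm (x t - x0) \<le> 2 * beta_F F x0 * (1 - exp (- t)))
       \<and> (\<exists>L. (x \<longlongrightarrow> L) at_top))"
proof (intro conjI allI impI; (elim conjE)?)
  note A = assms(1,3,4)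
  show "\<exists>x. x 0 = x0 \<and> newton_flow_sol F {0..} x" by (rule newton_flow_exists[OF A])
  fix x assume x0: "x 0 = x0" and sol: "newton_flow_sol F {0..} x"
  note inc = newton_flow_increment_bound[OF A sol x0]
  have \<beta>: "0 \<le> beta_F F x0" by (simp add: beta_F_def)
  show "\<exists>L. (x \<longlongrightarrow> L) at_top"
    by (rule converges_of_exponentially_small_increments[OF inc]) (use \<beta> in simp_all)
  fix t :: real assume t: "0 \<le> t"
  show "F (x t) = exp (- t) *\<^sub>R F x0"
    using newton_flow_residual[OF real_analytic_imp_smooth[OF assms(1)] sol t] x0 by simp
  have "norm (x t - x0) \<le> 121 / 73 * beta_F F x0 * (1 - exp (- t))"
    using inc[OF order_refl t] x0 by simp
  also have "\<dots> \<le> 2 * beta_F F x0 * (1 - exp (- t))"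
    using \<beta> t by (intro mult_right_mono) auto
  finally show "norm (x t - x0) \<le> 2 * beta_F F x0 * (1 - exp (- t))" .
qed

end
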